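(* For every $x$ with $0<x\le2$, the sequence of probability measures $\{\widehat{T}^n\delta_x\}$ converges to $f^*\,dx$ as $n\to\infty$; that is, $\langle g,\widehat{T}^n\delta_x\rangle\to\int_0^2 g(t)f^*(t)\,dt$ for every $g\in C[0,2]$. Here $\delta_x$ is the unit point mass at $x$.
   Context: $\mathcal{M}^+$ is the set of bounded non-negative Borel measures on $[0,2]$ and $\langle g,\mu\rangle=\int_0^2 g\,d\mu$ for $g\in C[0,2]$. Define linear operators on $\mathcal{M}^+$ by $$\langle g,U\mu\rangle=\int_{[0,1]}g(2x)\,\mu(dx),\qquad \langle g,V\mu\rangle=\int_{(1,2]}\Big(\frac1{x-1}\int_0^{2(x-1)}g(y)\,dy\Big)\mu(dx),$$ $T=U+V$, and for $\mu\ne0$, $\widehat{T}\mu=\frac{1}{(T\mu)[0,2]}T\mu$. $f^*$ is the probability density on $(0,2]$ of the form $f^*(t)=\ell^*\log(t)+\sum_{k=0}^\infty a_k^*(t-1)^k$ with $|\ell^*|+\sum_k|a_k^*|<\infty$ which satisfies $$(1+C)f^*(x)=\tfrac12 f^*(x/2)+\int_{1+x/2}^2\frac{f^*(y)}{y-1}\,dy\quad (x\in(0,2]),\qquad C=\int_1^2 f^*(y)\,dy .$$ It exists and is the limit, uniformly on compact subsets of $(0,2]$, of the iteration $(1+C_s)f_{s+1}(x)=\tfrac12 f_s(x/2)+\int_{1+x/2}^2\frac{f_s(y)}{y-1}\,dy$, $C_s=\int_1^2f_s$, started from any probability density $f_0(t)=\ell\log(t)+\sum_{k\ge0}a_k(t-1)^k$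 with $(\ell,a_0,a_1,\dots)\in\ell^1$. *)

theory Defs
  imports "HOL-Probability.Probability"
begin

abbreviation I02 :: "real measure" where
  "I02 \<equiv> restrict_space borel {0..2}"

definition Mplus :: "real measure set" where
  "Mplus = {\<mu>. sets \<mu> = sets I02 \<and> finite_measure \<mu>}"

definition pairing :: "(real \<Rightarrow> real) \<Rightarrow> real measure \<Rightarrow> real" where
  "pairing g \<mu> = (LINT x|\<mu>. g x)"

text \<open>The measure representing a functional on \<open>C[0,2]\<close>. There is at most one
  (\<open>Mplus_eqI\<close> below), and for the two functionals used here one exists (\<open>U_spec\<close>, \<open>V_spec\<close>).\<close>

definition represents :: "real measure \<Rightarrow> ((real \<Rightarrow> real) \<Rightarrow> real) \<Rightarrow> bool" where
  "represents \<nu> \<Phi> \<longleftrightarrow> \<nu> \<in> Mplus \<and> (\<forall>g. continuous_on {0..2} g \<longrightarrow> pairing g \<nu> = \<Phi> g)"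

definition opU :: "real measure \<Rightarrow> real measure" where
  "opU \<mu> = (THE \<nu>. represents \<nu> (\<lambda>g. LINT x:{0..1}|\<mu>. g (2 * x)))"

definition opV :: "real measure \<Rightarrow> real measure" where
  "opV \<mu> = (THE \<nu>. represents \<nu>
     (\<lambda>g. LINT x:{1<..2}|\<mu>. 1 / (x - 1) * (LBINT y:{0..2 * (x - 1)}. g y)))"

definition opT :: "real measure \<Rightarrow> real measure" where
  "opT \<mu> = measure_of {0..2} (sets I02) (\<lambda>A. emeasure (opU \<mu>) A + emeasure (opV \<mu>) A)"

definition That :: "real measure \<Rightarrow> real measure" where
  "That \<mu> = scale_measure (ennreal (1 / measure (opT \<mu>) {0..2})) (opT \<mu>)"

text \<open>Only the values of \<open>f\<close> on \<open>(0,2]\<close> matter.\<close>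

definition upper_mass :: "(real \<Rightarrow> real) \<Rightarrow> real" where
  "upper_mass f = (LBINT y:{1..2}. f y)"

definition prob_density :: "(real \<Rightarrow> real) \<Rightarrow> bool" where
  "prob_density f \<longleftrightarrow> (\<forall>t\<in>{0<..2}. 0 \<le> f t) \<and>
     set_integrable lborel {0<..2} f \<and> (LBINT t:{0<..2}. f t) = 1"

definition log_series_form :: "(real \<Rightarrow> real) \<Rightarrow> bool" where
  "log_series_form f \<longleftrightarrow> (\<exists>(l::real) (a::nat \<Rightarrow> real). summable (\<lambda>k. \<bar>a k\<bar>) \<and>
     (\<forall>t\<in>{0<..2}. f t = l * ln t + (\<Sum>k. a k * (t - 1) ^ k)))"

definition is_fstar :: "(real \<Rightarrow> real) \<Rightarrow> bool" where
  "is_fstar f \<longleftrightarrow> prob_density f \<and> log_series_form f \<and>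
     (\<forall>x\<in>{0<..2}. (1 + upper_mass f) * f x
        = 1 / 2 * f (x / 2) + (LBINT y:{1 + x / 2..2}. f y / (y - 1)))"


section \<open>The operators are well defined\<close>

lemma MplusD:
  assumes "\<mu> \<in> Mplus"
  shows "sets \<mu> = sets I02" "space \<mu> = {0..2}" "finite_measure \<mu>"
  using assms sets_eq_imp_space_eq[of \<mu> I02] by (auto simp: Mplus_def space_restrict_space)

lemma sets_I02: "A \<subseteq> {0..2} \<Longrightarrow> A \<in> sets borel \<Longrightarrow> A \<in> sets I02"
  by (auto simp: sets_restrict_space_iff)

lemma continuous_bounded:
  fixes g :: "real \<Rightarrow> real"
  assumes "continuous_on {0..2} g"
  obtains B where "\<And>x. x \<in> {0..2} \<Longrightarrow> \<bar>g x\<bar> \<le> B"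
proof -
  have "compact (g ` {0..2})" using assms by (intro compact_continuous_image) auto
  then have "bounded (g ` {0..2})" by (rule compact_imp_bounded)
  then obtain B where "\<forall>y\<in>g ` {0..2}. norm y \<le> B" unfolding bounded_iff by blast
  then show ?thesis by (intro that[of B]) auto
qed

lemma continuous_measurable:
  fixes g :: "real \<Rightarrow> real"
  shows "continuous_on {0..2} g \<Longrightarrow> g \<in> borel_measurable I02"
  by (rule borel_measurable_continuous_on_restrict)

lemma tail_limit:
  assumes "\<mu> \<in> Mplus"
  shows "(\<lambda>n. pairing (\<lambda>y. min 1 (max 0 (real n * (y - x)))) \<mu>)
           \<longlonglongrightarrow> measure \<mu> ({x<..} \<inter> {0..2})"
proof -
  interpret finite_measure \<mu> using MplusD[OF assms] by simp
  have ms[measurable_cong]: "sets \<mu> = sets I02" using MplusD[OF assms] by simp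
  have A: "{x<..} \<inter> {0..2} \<in> sets \<mu>" unfolding ms by (intro sets_I02) auto
  have "(\<lambda>n. LINT y|\<mu>. min 1 (max 0 (real n * (y - x))))
      \<longlonglongrightarrow> (LINT y|\<mu>. indicator ({x<..} \<inter> {0..2}) y)"
  proof (rule integral_dominated_convergence[where w="\<lambda>_. 1"])
    show "(\<lambda>y. indicator ({x<..} \<inter> {0..2}) y :: real) \<in> borel_measurable \<mu>" using A by simp
    show "(\<lambda>y. min 1 (max 0 (real n * (y - x)))) \<in> borel_measurable \<mu>" for n
      unfolding measurable_cong_sets[OF ms refl]
      by (intro continuous_measurable continuous_intros)
    show "integrable \<mu> (\<lambda>_. 1 :: real)" by simp
    show "AE y in \<mu>. (\<lambda>n. min 1 (max 0 (real n * (y - x))))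
        \<longlonglongrightarrow> indicator ({x<..} \<inter> {0..2}) y"
    proof (rule AE_I2)
      fix y assume "y \<in> space \<mu>"
      then have y: "y \<in> {0..2}" using MplusD[OF assms] by simp
      show "(\<lambda>n. min 1 (max 0 (real n * (y - x)))) \<longlonglongrightarrow> indicator ({x<..} \<inter> {0..2}) y"
      proof (cases "x < y")
        case True
        obtain N :: nat where N: "1 / (y - x) < N" using reals_Archimedean2 by blast
        have "min 1 (max 0 (real n * (y - x))) = 1" if "n \<ge> N" for n
        proof -
          have "1 / (y - x) \<le> real n" using N that by linarith
          then have "1 \<le> real n * (y - x)" using True by (simp add: field_simps)
          then show ?thesis by simp
        qed
        then have "eventually (\<lambda>n. min 1 (max 0 (real n * (y - x))) = 1) sequentially"
          unfolding eventually_sequentially by blast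
        then show ?thesis using True y by (auto intro: tendsto_eventually)
      next
        case False
        then have "real n * (y - x) \<le> 0" for n by (simp add: mult_nonneg_nonpos)
        then show ?thesis using False by simp
      qed
    qed
    show "AE y in \<mu>. norm (min 1 (max 0 (real n * (y - x)))) \<le> 1" for n by simp
  qed
  also have "(LINT y|\<mu>. indicator ({x<..} \<inter> {0..2}) y) = measure \<mu> ({x<..} \<inter> {0..2})"
    using MplusD[OF assms] by (simp add: Int_assoc)
  finally show ?thesis unfolding pairing_def .
qed

lemma Mplus_eqI:
  assumes M: "\<mu> \<in> Mplus" "\<nu> \<in> Mplus"
    and eq: "\<And>g. continuous_on {0..2} g \<Longrightarrow> pairing g \<mu> = pairing g \<nu>"
  shows "\<mu> = \<nu>"
proof -
  interpret m: finite_measure \<mu> using MplusD[OF M(1)] by simp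
  interpret n: finite_measure \<nu> using MplusD[OF M(2)] by simp
  have id: "(\<lambda>x. x) \<in> measurable \<rho> borel" if "\<rho> \<in> Mplus" for \<rho>
    unfolding measurable_cong_sets[OF MplusD(1)[OF that] refl]
    by (intro continuous_measurable continuous_intros)
  have *: "measure \<mu> ({x<..} \<inter> {0..2}) = measure \<nu> ({x<..} \<inter> {0..2})" for x
  proof (rule LIMSEQ_unique[OF tail_limit[OF M(1), of x]])
    have "pairing (\<lambda>y. min 1 (max 0 (real n * (y - x)))) \<mu>
        = pairing (\<lambda>y. min 1 (max 0 (real n * (y - x)))) \<nu>" for n
      by (intro eq continuous_intros)
    then show "(\<lambda>n. pairing (\<lambda>y. min 1 (max 0 (real n * (y - x)))) \<mu>)
        \<longlonglongrightarrow> measure \<nu> ({x<..} \<inter> {0..2})"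
      using tail_limit[OF M(2), of x] by simp
  qed
  have **: "distr \<mu> borel (\<lambda>x. x) = distr \<nu> borel (\<lambda>x. x)"
  proof (rule measure_eqI_lessThan)
    show "emeasure (distr \<mu> borel (\<lambda>x. x)) {x<..} = emeasure (distr \<nu> borel (\<lambda>x. x)) {x<..}" for x
      using *[of x] MplusD[OF M(1)] MplusD[OF M(2)] id[OF M(1)] id[OF M(2)]
      by (simp add: emeasure_distr m.emeasure_eq_measure n.emeasure_eq_measure)
    show "emeasure (distr \<mu> borel (\<lambda>x. x)) {x<..} < \<infinity>" for x
      using id[OF M(1)] by (simp add: emeasure_distr m.emeasure_eq_measure)
  qed auto
  show ?thesis
  proof (rule measure_eqI)
    show "sets \<mu> = sets \<nu>" using MplusD[OF M(1)] MplusD[OF M(2)] by simp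
    fix A assume "A \<in> sets \<mu>"
    then have A: "A \<in> sets borel" "A \<inter> {0..2} = A"
      using MplusD[OF M(1)] by (auto simp: sets_restrict_space_iff)
    have "emeasure (distr \<mu> borel (\<lambda>x. x)) A = emeasure (distr \<nu> borel (\<lambda>x. x)) A"
      using ** by simp
    then show "emeasure \<mu> A = emeasure \<nu> A"
      using A MplusD[OF M(1)] MplusD[OF M(2)] id[OF M(1)] id[OF M(2)]
      by (simp add: emeasure_distr)
  qed
qed

lemma the_represents:
  assumes "represents \<nu> \<Phi>"
  shows "represents (THE \<nu>. represents \<nu> \<Phi>) \<Phi>"
proof (rule theI[where P="\<lambda>\<nu>. represents \<nu> \<Phi>", OF assms])
  fix \<nu>' assume "represents \<nu>' \<Phi>"
  then show "\<nu>' = \<nu>" using assms unfolding represents_def by (intro Mplus_eqI) auto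
qed

lemma U_spec:
  assumes "\<mu> \<in> Mplus"
  shows "represents (opU \<mu>) (\<lambda>g. LINT x:{0..1}|\<mu>. g (2 * x))"
  unfolding opU_def
proof (rule the_represents)
  let ?R = "restrict_space \<mu> {0..1}"
  interpret finite_measure \<mu> using MplusD[OF assms] by simp
  have S: "{0..1} \<in> sets \<mu>" unfolding MplusD(1)[OF assms] by (intro sets_I02) auto
  interpret R: finite_measure ?R
    using S by (intro finite_measure_restrict_space) (auto simp: finite_measure_axioms)
  have sp: "space ?R = {0..1}" using MplusD[OF assms] by (auto simp: space_restrict_space)
  have m: "(\<lambda>x. 2 * x) \<in> measurable ?R I02"
  proof (rule measurable_restrict_space2)
    show "(\<lambda>x. 2 * x) \<in> space ?R \<rightarrow> {0..2}" unfolding sp by auto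
    have "(\<lambda>x::real. 2 * x) \<in> borel_measurable \<mu>"
      unfolding measurable_cong_sets[OF MplusD(1)[OF assms] refl]
      by (intro continuous_measurable continuous_intros)
    then show "(\<lambda>x. 2 * x) \<in> borel_measurable ?R" by (rule measurable_restrict_space1)
  qed
  show "represents (distr ?R I02 (\<lambda>x. 2 * x)) (\<lambda>g. LINT x:{0..1}|\<mu>. g (2 * x))"
    unfolding represents_def
  proof (intro conjI allI impI)
    show "distr ?R I02 (\<lambda>x. 2 * x) \<in> Mplus"
      unfolding Mplus_def using R.finite_measure_distr[OF m] by simp
    fix g :: "real \<Rightarrow> real" assume g: "continuous_on {0..2} g"
    show "pairing g (distr ?R I02 (\<lambda>x. 2 * x)) = (LINT x:{0..1}|\<mu>. g (2 * x))"
      unfolding pairing_def integral_distr[OF m continuous_measurable[OF g]]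
        set_lebesgue_integral_def
      using S by (simp add: integral_restrict_space)
  qed
qed

lemma average_eq:
  fixes g :: "real \<Rightarrow> real"
  assumes "1 < x"
  shows "1 / (x - 1) * (LBINT y:{0..2 * (x - 1)}. g y) = (LBINT s:{0..2}. g ((x - 1) * s))"
proof -
  have "(LBINT y:{0..2 * (x - 1)}. g y)
      = \<bar>x - 1\<bar> * (LBINT s. indicator {0..2 * (x - 1)} (0 + (x - 1) * s) * g (0 + (x - 1) * s))"
    unfolding set_lebesgue_integral_def
    using lborel_integral_real_affine[of "x - 1" "\<lambda>y. indicator {0..2 * (x - 1)} y * g y" 0] assms
    by simp
  also have "(LBINT s. indicator {0..2 * (x - 1)} (0 + (x - 1) * s) * g (0 + (x - 1) * s))
      = (LBINT s:{0..2}. g ((x - 1) * s))"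
    unfolding set_lebesgue_integral_def
  proof (intro Bochner_Integration.integral_cong refl)
    fix s
    have "(x - 1) * s \<le> 2 * (x - 1) \<longleftrightarrow> s \<le> 2" "0 \<le> (x - 1) * s \<longleftrightarrow> 0 \<le> s"
      using assms mult_le_cancel_left_pos[of "x - 1" s 2]
      by (simp_all add: mult.commute zero_le_mult_iff)
    then show "indicator {0..2 * (x - 1)} (0 + (x - 1) * s) * g (0 + (x - 1) * s)
        = indicator {0..2} s *\<^sub>R g ((x - 1) * s)"
      by (simp add: indicator_def)
  qed
  finally show ?thesis using assms by simp
qed

lemma V_spec:
  assumes "\<mu> \<in> Mplus"
  shows "represents (opV \<mu>)
    (\<lambda>g. LINT x:{1<..2}|\<mu>. 1 / (x - 1) * (LBINT y:{0..2 * (x - 1)}. g y))"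
  unfolding opV_def
proof (rule the_represents)
  let ?R = "restrict_space \<mu> {1<..2}" and ?L = "restrict_space lborel {0..2::real}"
  let ?h = "\<lambda>(x, s). (x - 1) * s :: real"
  interpret finite_measure \<mu> using MplusD[OF assms] by simp
  have S: "{1<..2} \<in> sets \<mu>" unfolding MplusD(1)[OF assms] by (intro sets_I02) auto
  interpret R: finite_measure ?R
    using S by (intro finite_measure_restrict_space) (auto simp: finite_measure_axioms)
  interpret L: finite_measure ?L
    by (intro finite_measureI) (simp add: emeasure_restrict_space space_restrict_space)
  interpret P: pair_sigma_finite ?R ?L ..
  interpret P: finite_measure "?R \<Otimes>\<^sub>M ?L"
    by (intro finite_measure_pair_measure R.finite_measure_axioms L.finite_measure_axioms)
  have sp: "space ?R = {1<..2}" "space ?L = {0..2}"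
    using MplusD[OF assms] by (auto simp: space_restrict_space)
  have i1: "(\<lambda>x::real. x) \<in> borel_measurable ?R"
  proof (rule measurable_restrict_space1)
    show "(\<lambda>x::real. x) \<in> borel_measurable \<mu>"
      unfolding measurable_cong_sets[OF MplusD(1)[OF assms] refl]
      by (intro continuous_measurable continuous_intros)
  qed
  have i2: "(\<lambda>x::real. x) \<in> borel_measurable ?L"
    by (rule measurable_restrict_space1) simp
  have f: "fst \<in> borel_measurable (?R \<Otimes>\<^sub>M ?L)" "snd \<in> borel_measurable (?R \<Otimes>\<^sub>M ?L)"
    by (rule measurable_compose[OF measurable_fst i1] measurable_compose[OF measurable_snd i2])+
  have m: "?h \<in> measurable (?R \<Otimes>\<^sub>M ?L) I02"
  proof (rule measurable_restrict_space2)
    have "(x - 1) * s \<le> 1 * 2" if "1 < x" "x \<le> 2" "0 \<le> s" "s \<le> 2" for x s :: real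
      using that by (intro mult_mono) auto
    then show "?h \<in> space (?R \<Otimes>\<^sub>M ?L) \<rightarrow> {0..2}"
      unfolding space_pair_measure sp by auto
    show "?h \<in> borel_measurable (?R \<Otimes>\<^sub>M ?L)"
      unfolding case_prod_beta using f by measurable
  qed
  show "represents (distr (?R \<Otimes>\<^sub>M ?L) I02 ?h)
      (\<lambda>g. LINT x:{1<..2}|\<mu>. 1 / (x - 1) * (LBINT y:{0..2 * (x - 1)}. g y))"
    unfolding represents_def
  proof (intro conjI allI impI)
    show "distr (?R \<Otimes>\<^sub>M ?L) I02 ?h \<in> Mplus"
      unfolding Mplus_def using P.finite_measure_distr[OF m] by simp
    fix g :: "real \<Rightarrow> real" assume g: "continuous_on {0..2} g"
    obtain B where B: "\<And>x. x \<in> {0..2} \<Longrightarrow> \<bar>g x\<bar> \<le> B" using continuous_bounded[OF g] by blast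
    have gm: "(\<lambda>z. g (?h z)) \<in> borel_measurable (?R \<Otimes>\<^sub>M ?L)"
      by (rule measurable_compose[OF m continuous_measurable[OF g]])
    have int: "integrable (?R \<Otimes>\<^sub>M ?L) (\<lambda>z. g (?h z))"
    proof (rule P.integrable_const_bound[where B=B])
      show "AE z in ?R \<Otimes>\<^sub>M ?L. norm (g (?h z)) \<le> B"
        using B measurable_space[OF m] by (intro AE_I2) (auto simp: space_restrict_space)
    qed (rule gm)
    have "pairing g (distr (?R \<Otimes>\<^sub>M ?L) I02 ?h) = (LINT z|(?R \<Otimes>\<^sub>M ?L). g (?h z))"
      unfolding pairing_def by (rule integral_distr[OF m continuous_measurable[OF g]])
    also have "\<dots> = (LINT x|?R. LINT s|?L. g ((x - 1) * s))"
      using P.integral_fst'[OF int] by simp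
    also have "\<dots> = (LINT x|?R. 1 / (x - 1) * (LBINT y:{0..2 * (x - 1)}. g y))"
    proof (intro Bochner_Integration.integral_cong refl)
      fix x assume "x \<in> space ?R"
      then have "1 < x" unfolding sp by simp
      then show "(LINT s|?L. g ((x - 1) * s))
          = 1 / (x - 1) * (LBINT y:{0..2 * (x - 1)}. g y)"
        unfolding average_eq[OF \<open>1 < x\<close>]
        by (simp add: set_lebesgue_integral_def integral_restrict_space)
    qed
    also have "\<dots> = (LINT x:{1<..2}|\<mu>. 1 / (x - 1) * (LBINT y:{0..2 * (x - 1)}. g y))"
      unfolding set_lebesgue_integral_def using S by (simp add: integral_restrict_space)
    finally show "pairing g (distr (?R \<Otimes>\<^sub>M ?L) I02 ?h)
        = (LINT x:{1<..2}|\<mu>. 1 / (x - 1) * (LBINT y:{0..2 * (x - 1)}. g y))" .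
  qed
qed

lemma sets_T [simp]: "sets (opT \<mu>) = sets I02" and space_T [simp]: "space (opT \<mu>) = {0..2}"
proof -
  interpret sigma_algebra "{0..2::real}" "sets I02"
    using sets.sigma_algebra_axioms[of I02] by (simp add: space_restrict_space)
  show "sets (opT \<mu>) = sets I02" "space (opT \<mu>) = {0..2}"
    unfolding opT_def by (simp_all add: sets_measure_of_eq space_measure_of_eq)
qed

lemma emeasure_T:
  assumes "\<mu> \<in> Mplus" "A \<in> sets I02"
  shows "emeasure (opT \<mu>) A = emeasure (opU \<mu>) A + emeasure (opV \<mu>) A"
proof -
  have UV: "sets (opU \<mu>) = sets I02" "sets (opV \<mu>) = sets I02"
    using U_spec[OF assms(1)] V_spec[OF assms(1)] MplusD unfolding represents_def by auto
  show ?thesis unfolding opT_def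
  proof (rule emeasure_measure_of_sigma)
    show "sigma_algebra {0..2::real} (sets I02)"
      using sets.sigma_algebra_axioms[of I02] by (simp add: space_restrict_space)
    show "positive (sets I02) (\<lambda>A. emeasure (opU \<mu>) A + emeasure (opV \<mu>) A)"
      by (simp add: positive_def)
    show "countably_additive (sets I02) (\<lambda>A. emeasure (opU \<mu>) A + emeasure (opV \<mu>) A)"
      unfolding countably_additive_def
      by (auto simp: UV suminf_emeasure suminf_add[symmetric] simp flip: UV(1))
  qed (rule assms(2))
qed

lemma T_Mplus:
  assumes "\<mu> \<in> Mplus"
  shows "opT \<mu> \<in> Mplus"
proof -
  have UV: "finite_measure (opU \<mu>)" "finite_measure (opV \<mu>)"
    using U_spec[OF assms(1)] V_spec[OF assms(1)] MplusD unfolding represents_def by auto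
  have "emeasure (opT \<mu>) {0..2} \<noteq> \<infinity>"
    using emeasure_T[OF assms, of "{0..2}"] sets_I02[of "{0..2}"]
      finite_measure.emeasure_finite[OF UV(1)] finite_measure.emeasure_finite[OF UV(2)]
    by simp
  then show ?thesis unfolding Mplus_def by (simp add: finite_measureI)
qed

lemma T_mass_pos:
  assumes "\<mu> \<in> Mplus" "measure \<mu> {0..2} \<noteq> 0"
  shows "measure (opT \<mu>) {0..2} > 0"
proof -
  have UVM: "opU \<mu> \<in> Mplus" "opV \<mu> \<in> Mplus"
    using U_spec[OF assms(1)] V_spec[OF assms(1)] unfolding represents_def by auto
  interpret m: finite_measure \<mu> using MplusD[OF assms(1)] by simp
  interpret u: finite_measure "opU \<mu>" using MplusD[OF UVM(1)] by simp
  interpret v: finite_measure "opV \<mu>" using MplusD[OF UVM(2)] by simp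
  interpret t: finite_measure "opT \<mu>" using MplusD[OF T_Mplus[OF assms(1)]] by simp
  have S: "{0..1} \<in> sets \<mu>" "{1<..2} \<in> sets \<mu>"
    unfolding MplusD(1)[OF assms(1)] by (intro sets_I02; auto)+
  have lint2: "(LBINT s:{0..2::real}. 1::real) = 2" by (simp add: set_integral_const)
  have one: "pairing (\<lambda>_. 1) \<nu> = measure \<nu> {0..2}" if "\<nu> \<in> Mplus" for \<nu>
    using MplusD[OF that] unfolding pairing_def by simp
  have "measure (opU \<mu>) {0..2} = (LINT x:{0..1}|\<mu>. 1)"
    using U_spec[OF assms(1)] unfolding represents_def one[OF UVM(1), symmetric] by simp
  also have "\<dots> = measure \<mu> {0..1}" using S by (simp add: set_integral_const)
  finally have u: "measure (opU \<mu>) {0..2} = measure \<mu> {0..1}" .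
  have "measure (opV \<mu>) {0..2} = (LINT x:{1<..2}|\<mu>. 1 / (x - 1) * (LBINT y:{0..2 * (x - 1)}. 1))"
    using V_spec[OF assms(1)] unfolding represents_def one[OF UVM(2), symmetric] by simp
  also have "\<dots> = (LINT x:{1<..2}|\<mu>. 2)"
    using S by (intro set_lebesgue_integral_cong) (auto simp only: greaterThanAtMost_iff average_eq lint2)
  also have "\<dots> = 2 * measure \<mu> {1<..2}" using S by (simp add: set_integral_const)
  finally have v: "measure (opV \<mu>) {0..2} = 2 * measure \<mu> {1<..2}" .
  have "{0..2::real} = {0..1} \<union> {1<..2}" by auto
  then have "measure \<mu> {0..2} = measure \<mu> {0..1} + measure \<mu> {1<..2}"
    using m.finite_measure_Union[OF S] by (simp add: disjoint_iff)
  moreover have "measure (opT \<mu>) {0..2} = measure (opU \<mu>) {0..2} + measure (opV \<mu>) {0..2}"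
    using emeasure_T[OF assms(1), of "{0..2}"] sets_I02[of "{0..2}"]
    by (simp add: u.emeasure_eq_measure v.emeasure_eq_measure t.emeasure_eq_measure
      flip: ennreal_plus)
  ultimately show ?thesis
    using u v assms(2) measure_nonneg[of \<mu> "{0..1}"] measure_nonneg[of \<mu> "{1<..2}"] by linarith
qed

lemma That_prob:
  assumes "\<mu> \<in> Mplus" "measure \<mu> {0..2} \<noteq> 0"
  shows "That \<mu> \<in> Mplus" "prob_space (That \<mu>)"
proof -
  interpret t: finite_measure "opT \<mu>" using MplusD[OF T_Mplus[OF assms(1)]] by simp
  show *: "prob_space (That \<mu>)"
    using T_mass_pos[OF assms]
    by (intro prob_spaceI) (simp add: That_def space_scale_measure t.emeasure_eq_measure
      flip: ennreal_mult)
  then show "That \<mu> \<in> Mplus"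
    unfolding Mplus_def by (simp add: That_def prob_space.finite_measure)
qed

lemma That_iterate_prob:
  assumes "0 \<le> x" "x \<le> 2"
  shows "(That ^^ n) (return I02 x) \<in> Mplus \<and> prob_space ((That ^^ n) (return I02 x))"
proof (induction n)
  case 0
  have "prob_space (return I02 x)"
    using assms by (intro prob_space_return) (simp add: space_restrict_space)
  then show ?case by (simp add: Mplus_def prob_space.finite_measure)
next
  case (Suc n)
  then have "measure ((That ^^ n) (return I02 x)) {0..2} = 1"
    using MplusD(2) prob_space.prob_space by metis
  then show ?case using Suc That_prob by simp
qed

end

theory Submission
  imports Defs begin

text \<open>Let \<open>S\<close> be the operator dual to \<open>T\<close> (\<open>dualT\<close> below), acting on nonnegative Borel functions. Then
  \<open>\<langle>g, That^n \<delta>_x\<rangle>\<close> is the ratio \<open>(S^n g)(x) / (S^n 1)(x)\<close>. The functional \<open>F g = \<integral> g f*\<close> satisfies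
  \<open>F (S g) = (1 + C) F g\<close>, and since \<open>f*\<close> has only a logarithmic singularity at \<open>0\<close>, two
  applications of \<open>S\<close> give the Doeblin bound \<open>S (S g) \<ge> \<epsilon> F(g)\<close> on \<open>(7/4, 2)\<close>. Because \<open>f*\<close> is bounded
  below by a positive constant, for some \<open>n\<close> the functional \<open>g \<mapsto> (1 + C)^(-n) (S^n g)(x)\<close> lies
  between \<open>a F\<close> and \<open>b F\<close> with \<open>0 < a \<le> b\<close>, and the Doeblin bound shrinks \<open>b - a\<close> by a fixed factor
  every two steps.\<close>

section \<open>The dual operator\<close>

text \<open>\<open>opU\<close> and \<open>opV\<close> are pinned down only by tests against
  continuous functions, but \<open>dualT\<close> does not preserve continuity: for continuous g it
  jumps at 1 from g(2) to 2 g(0). So the formulas for \<open>opU\<close> and \<open>opV\<close> must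
  first be extended to all nonnegative Borel functions; values in \<open>ennreal\<close> then spare
  the integrability checks along the iteration.

  One application of S cannot dominate the density: at a fixed point it is a point value or an
  average with bounded weight, while the density may be unbounded at 0. A second application
  integrates these averages over their parameter t, and the weight 1/(t - 1) integrates to -ln y,
  exactly the singularity that is allowed.

  For x <= 1 the value (S^n g)(x) remains a point evaluation, not controlled by F, until doubling
  has carried x into (1,2]. Every x in (0,2] gets there, the point 0 never does; this is why the
  two-sided bound starts only at some n depending on x.\<close>

definition dualT :: "(real \<Rightarrow> ennreal) \<Rightarrow> real \<Rightarrow> ennreal" where
  "dualT g x = (if x \<le> 1 then g (2 * x) else \<integral>\<^sup>+s. g ((x - 1) * s) * indicator {0..2} s \<partial>lborel)"

lemma dualT_measurable [measurable]:
  assumes [measurable]: "g \<in> borel_measurable borel"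
  shows "dualT g \<in> borel_measurable borel"
  unfolding dualT_def by measurable

lemma dualT_funpow_measurable [measurable]:
  "g \<in> borel_measurable borel \<Longrightarrow> (dualT ^^ n) g \<in> borel_measurable borel"
  by (induction n) auto

lemma dualT_add_scaled:
  assumes [measurable]: "g \<in> borel_measurable borel" "h \<in> borel_measurable borel"
  shows "dualT (\<lambda>x. c * g x + h x) = (\<lambda>x. c * dualT g x + dualT h x)"
  unfolding dualT_def
  by (auto simp: fun_eq_iff nn_integral_add nn_integral_cmult distrib_right mult.assoc)

lemma dualT_funpow_add_scaled:
  assumes "g \<in> borel_measurable borel" "h \<in> borel_measurable borel"
  shows "(dualT ^^ n) (\<lambda>x. c * g x + h x) = (\<lambda>x. c * (dualT ^^ n) g x + (dualT ^^ n) h x)"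
  using assms by (induction n) (simp_all add: dualT_add_scaled dualT_funpow_measurable)

lemma dualT_mono: "(\<And>x. g x \<le> h x) \<Longrightarrow> dualT g x \<le> dualT h x"
  unfolding dualT_def by (auto intro!: nn_integral_mono mult_right_mono)

lemma dualT_funpow_mono: "(\<And>x. g x \<le> h x) \<Longrightarrow> (dualT ^^ n) g x \<le> (dualT ^^ n) h x"
  by (induction n arbitrary: x) (auto intro: dualT_mono)

text \<open>The substitution y = (x - 1) s. The definition uses s because it has no singular factor;
  the form in y displays the interval of integration, which is what Tonelli and comparisons between
  intervals need.\<close>

lemma dualT_average:
  assumes [measurable]: "g \<in> borel_measurable borel" and "1 < x"
  shows "dualT g x = ennreal (1 / (x - 1)) * (\<integral>\<^sup>+y. g y * indicator {0..2 * (x - 1)} y \<partial>lborel)"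
proof -
  have ind: "indicator {0..2 * (x - 1)} ((x - 1) * s) = (indicator {0..2} s :: ennreal)" for s
    using assms(2) mult_le_cancel_left_pos[of "x - 1" s 2]
    by (auto simp: indicator_def zero_le_mult_iff mult.commute)
  have "(\<integral>\<^sup>+y. g y * indicator {0..2 * (x - 1)} y \<partial>lborel)
      = ennreal \<bar>x - 1\<bar> * (\<integral>\<^sup>+s. g (0 + (x - 1) * s) * indicator {0..2 * (x - 1)} (0 + (x - 1) * s) \<partial>lborel)"
    using assms(2) by (intro nn_integral_real_affine) auto
  also have "\<dots> = ennreal (x - 1) * dualT g x"
    using assms(2) by (simp only: ind add_0 dualT_def) simp
  finally have *: "(\<integral>\<^sup>+y. g y * indicator {0..2 * (x - 1)} y \<partial>lborel) = ennreal (x - 1) * dualT g x" .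
  have "ennreal (1 / (x - 1)) * ennreal (x - 1) = 1"
    using assms(2) by (subst ennreal_mult'[symmetric]) auto
  then show ?thesis unfolding * by (simp flip: mult.assoc)
qed

text \<open>Since x is nonnegative and 2^k x <= 2, the points x, 2x, ..., 2^(k-1) x are all at most
  1, so only the doubling branch of \<open>dualT\<close> is ever used.\<close>

lemma dualT_funpow_doubling: "2 ^ k * x \<le> 2 \<Longrightarrow> 0 \<le> x \<Longrightarrow> (dualT ^^ k) g x = g (2 ^ k * x)"
proof (induction k arbitrary: x)
  case (Suc k)
  have "1 * x \<le> 2 ^ k * x" using Suc.prems by (intro mult_right_mono) auto
  then have "x \<le> 1" using Suc.prems by simp
  then have "(dualT ^^ Suc k) g x = (dualT ^^ k) g (2 * x)" by (simp add: dualT_def)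
  also have "\<dots> = g (2 ^ k * (2 * x))" using Suc.prems by (intro Suc.IH) (auto simp: mult.assoc mult.commute)
  finally show ?case by (simp add: mult.assoc mult.left_commute)
qed simp

text \<open>Substitution y = 2t in the doubling branch, which produces the factor 1/2, and Tonelli
  in the averaging branch. The weight \<open>w\<close> is arbitrary because two instances matter:
  \<open>dens\<close>, which reproduces the equation for the stationary density, and the indicator
  of [0,3/2], which produces the logarithmic kernel of the Doeblin bound.\<close>

lemma dualT_duality:
  assumes [measurable]: "g \<in> borel_measurable borel" "w \<in> borel_measurable borel"
  shows "(\<integral>\<^sup>+t. w t * dualT g t \<partial>lborel)
    = (\<integral>\<^sup>+y. g y * (ennreal (1 / 2) * w (y / 2) * indicator {..2} y
        + (\<integral>\<^sup>+t. w t * ennreal (1 / (t - 1)) * indicator {t. 1 < t \<and> 0 \<le> y \<and> y \<le> 2 * (t - 1)} t \<partial>lborel)) \<partial>lborel)"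
proof -
  let ?k = "\<lambda>t y. w t * ennreal (1 / (t - 1)) * indicator {t. 1 < t \<and> 0 \<le> y \<and> y \<le> 2 * (t - 1)} t"
  have [measurable]: "(\<lambda>(t, y). g y * ?k t y) \<in> borel_measurable (lborel \<Otimes>\<^sub>M lborel)"
    unfolding case_prod_beta by measurable
  have [measurable]: "(\<lambda>(y, t). ?k t y) \<in> borel_measurable (lborel \<Otimes>\<^sub>M lborel)"
    unfolding case_prod_beta by measurable
  have a: "(\<integral>\<^sup>+t. w t * g (2 * t) * indicator {..1} t \<partial>lborel)
      = (\<integral>\<^sup>+y. g y * (ennreal (1 / 2) * w (y / 2) * indicator {..2} y) \<partial>lborel)"
    by (subst nn_integral_real_affine[where c="1/2" and t=0])
       (auto simp: nn_integral_cmult[symmetric] indicator_def intro!: nn_integral_cong, auto simp: ac_simps)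
  have b: "w t * dualT g t * indicator {1<..} t = (\<integral>\<^sup>+y. g y * ?k t y \<partial>lborel)" for t
  proof (cases "1 < t")
    case True
    then show ?thesis
      by (simp add: dualT_average nn_integral_cmult[symmetric])
         (auto intro!: nn_integral_cong simp: indicator_def ac_simps)
  qed simp
  have "(\<integral>\<^sup>+t. w t * dualT g t \<partial>lborel)
      = (\<integral>\<^sup>+t. w t * g (2 * t) * indicator {..1} t + w t * dualT g t * indicator {1<..} t \<partial>lborel)"
    by (intro nn_integral_cong) (auto simp: dualT_def indicator_def)
  also have "\<dots> = (\<integral>\<^sup>+t. w t * g (2 * t) * indicator {..1} t \<partial>lborel)
      + (\<integral>\<^sup>+t. w t * dualT g t * indicator {1<..} t \<partial>lborel)"
    by (intro nn_integral_add) auto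
  also have "(\<integral>\<^sup>+t. w t * dualT g t * indicator {1<..} t \<partial>lborel)
      = (\<integral>\<^sup>+t. \<integral>\<^sup>+y. g y * ?k t y \<partial>lborel \<partial>lborel)"
    unfolding b ..
  also have "\<dots> = (\<integral>\<^sup>+y. \<integral>\<^sup>+t. g y * ?k t y \<partial>lborel \<partial>lborel)"
    by (rule lborel_pair.Fubini'[symmetric]) measurable
  also have "\<dots> = (\<integral>\<^sup>+y. g y * (\<integral>\<^sup>+t. ?k t y \<partial>lborel) \<partial>lborel)"
    by (intro nn_integral_cong nn_integral_cmult) measurable
  finally show ?thesis unfolding a
    by (simp add: nn_integral_add[symmetric] distrib_left)
qed

section \<open>Duality between measures and functions\<close>

text \<open>An explicit measure whose integrals are known for every Borel function. With
  \<open>w\<close> the indicator of {..1} or {1<..} it can be compared with \<open>opU\<close> or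
  \<open>opV\<close> on continuous functions, and uniqueness then transfers the Borel
  formula.\<close>

lemma kernel_measure:
  assumes M: "\<mu> \<in> Mplus" and [measurable]: "w \<in> borel_measurable borel" and w: "\<And>x. w x \<le> 1"
  obtains \<nu> where "\<nu> \<in> Mplus"
    "\<And>g. g \<in> borel_measurable borel \<Longrightarrow> (\<integral>\<^sup>+x. g x \<partial>\<nu>) = (\<integral>\<^sup>+x. w x * dualT g x \<partial>\<mu>)"
proof -
  let ?L = "restrict_space lborel {0..2::real}"
  define h where "h = (\<lambda>(x, s). if x \<le> 1 then 2 * x else (x - 1) * s :: real)"
  \<comment> \<open>For x <= 1 the coordinate s does not enter \<open>h\<close>; integrating it over
    [0,2] contributes a factor 2, which the weight 1/2 cancels.\<close>
  define v where "v = (\<lambda>z :: real \<times> real. w (fst z) * (if fst z \<le> 1 then ennreal (1 / 2) else 1))"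
  interpret finite_measure \<mu> using MplusD[OF M] by simp
  interpret L: finite_measure ?L
    by (intro finite_measureI) (simp add: emeasure_restrict_space space_restrict_space)
  have id: "(\<lambda>x. x) \<in> borel_measurable \<mu>"
    unfolding measurable_cong_sets[OF MplusD(1)[OF M] refl]
    by (intro continuous_measurable continuous_intros)
  have idL: "(\<lambda>x. x) \<in> borel_measurable ?L"
    by (rule measurable_restrict_space1) simp
  have [measurable]: "fst \<in> borel_measurable (\<mu> \<Otimes>\<^sub>M ?L)" "snd \<in> borel_measurable (\<mu> \<Otimes>\<^sub>M ?L)"
    by (rule measurable_compose[OF measurable_fst id] measurable_compose[OF measurable_snd idL])+
  have [measurable]: "v \<in> borel_measurable (\<mu> \<Otimes>\<^sub>M ?L)" unfolding v_def by measurable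
  have h_le: "(x - 1) * s \<le> 1 * 2" if "1 < x" "x \<le> 2" "0 \<le> s" "s \<le> 2" for x s :: real
    using that by (intro mult_mono) auto
  have hm: "h \<in> measurable (\<mu> \<Otimes>\<^sub>M ?L) I02"
  proof (rule measurable_restrict_space2)
    show "h \<in> space (\<mu> \<Otimes>\<^sub>M ?L) \<rightarrow> {0..2}"
      using h_le by (auto simp: h_def space_pair_measure MplusD(2)[OF M] space_restrict_space)
    show "h \<in> borel_measurable (\<mu> \<Otimes>\<^sub>M ?L)" unfolding h_def case_prod_beta by measurable
  qed
  define \<nu> where "\<nu> = distr (density (\<mu> \<Otimes>\<^sub>M ?L) v) I02 h"
  have nn: "(\<integral>\<^sup>+x. g x \<partial>\<nu>) = (\<integral>\<^sup>+x. w x * dualT g x \<partial>\<mu>)"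
    if [measurable]: "g \<in> borel_measurable borel" for g
  proof -
    have [measurable]: "(\<lambda>z. g (h z)) \<in> borel_measurable (\<mu> \<Otimes>\<^sub>M ?L)"
      by (rule measurable_compose[OF hm]) (simp add: measurable_restrict_space1)
    have "(\<integral>\<^sup>+x. g x \<partial>\<nu>) = (\<integral>\<^sup>+z. g (h z) \<partial>density (\<mu> \<Otimes>\<^sub>M ?L) v)"
      unfolding \<nu>_def using hm by (intro nn_integral_distr) (auto simp: measurable_restrict_space1)
    also have "\<dots> = (\<integral>\<^sup>+z. v z * g (h z) \<partial>(\<mu> \<Otimes>\<^sub>M ?L))"
      by (rule nn_integral_density) measurable
    also have "\<dots> = (\<integral>\<^sup>+x. \<integral>\<^sup>+s. v (x, s) * g (h (x, s)) \<partial>?L \<partial>\<mu>)"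
      by (rule L.nn_integral_fst[symmetric]) measurable
    also have "\<dots> = (\<integral>\<^sup>+x. w x * dualT g x \<partial>\<mu>)"
    proof (intro nn_integral_cong)
      fix x
      have "(\<integral>\<^sup>+s. v (x, s) * g (h (x, s)) \<partial>?L) = (\<integral>\<^sup>+s. v (x, s) * g (h (x, s)) * indicator {0..2} s \<partial>lborel)"
        by (simp add: nn_integral_restrict_space)
      also have "\<dots> = w x * dualT g x"
      proof (cases "x \<le> 1")
        case True
        have "ennreal (1 / 2) * 2 = 1"
          using ennreal_mult[of "1/2" 2] by simp
        then show ?thesis using True
          by (simp add: v_def h_def dualT_def nn_integral_cmult) (simp add: mult.assoc mult.commute mult.left_commute, simp flip: mult.assoc)
      next
        case False
        then show ?thesis
          by (simp add: v_def h_def dualT_def nn_integral_cmult mult.assoc)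
      qed
      finally show "(\<integral>\<^sup>+s. v (x, s) * g (h (x, s)) \<partial>?L) = w x * dualT g x" .
    qed
    finally show ?thesis .
  qed
  have s\<nu>: "sets \<nu> = sets I02" "space \<nu> = {0..2}"
    by (simp_all add: \<nu>_def space_restrict_space)
  have "emeasure \<nu> (space \<nu>) = (\<integral>\<^sup>+x. 1 \<partial>\<nu>)" by simp
  also have "\<dots> = (\<integral>\<^sup>+x. w x * dualT (\<lambda>_. 1) x \<partial>\<mu>)" by (rule nn) simp
  also have "\<dots> \<le> (\<integral>\<^sup>+x. 2 \<partial>\<mu>)"
  proof (intro nn_integral_mono)
    fix x
    have "w x * dualT (\<lambda>_. 1) x \<le> 1 * 2"
      using w by (intro mult_mono) (auto simp: dualT_def)
    then show "w x * dualT (\<lambda>_. 1) x \<le> 2" by simp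
  qed
  also have "\<dots> < \<infinity>" by (simp add: ennreal_mult_less_top emeasure_eq_measure)
  finally have "\<nu> \<in> Mplus" unfolding Mplus_def using s\<nu> by (auto intro: finite_measureI)
  then show ?thesis using nn that by blast
qed

lemma pairing_add_const:
  assumes "\<mu> \<in> Mplus" "continuous_on {0..2} g"
  shows "pairing (\<lambda>x. g x + c) \<mu> = pairing g \<mu> + c * measure \<mu> {0..2}" "integrable \<mu> g"
proof -
  interpret finite_measure \<mu> using MplusD[OF assms(1)] by simp
  obtain B where B: "\<And>x. x \<in> {0..2} \<Longrightarrow> \<bar>g x\<bar> \<le> B" using continuous_bounded[OF assms(2)] by blast
  show *: "integrable \<mu> g"
    using continuous_measurable[OF assms(2)] B MplusD(2)[OF assms(1)]
    unfolding measurable_cong_sets[OF MplusD(1)[OF assms(1), symmetric] refl]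
    by (intro integrable_const_bound[where B = B]) auto
  show "pairing (\<lambda>x. g x + c) \<mu> = pairing g \<mu> + c * measure \<mu> {0..2}"
    unfolding pairing_def using * MplusD(2)[OF assms(1)] by simp
qed

lemma pairing_nn_integral:
  assumes "\<mu> \<in> Mplus" "continuous_on {0..2} g" "\<And>x. x \<in> {0..2} \<Longrightarrow> 0 \<le> g x"
  shows "pairing g \<mu> = enn2real (\<integral>\<^sup>+x. ennreal (g x) * indicator {0..2} x \<partial>\<mu>)"
proof -
  have "pairing g \<mu> = enn2real (\<integral>\<^sup>+x. ennreal (g x) \<partial>\<mu>)" unfolding pairing_def
    using continuous_measurable[OF assms(2)] assms(3) MplusD(2)[OF assms(1)]
    unfolding measurable_cong_sets[OF MplusD(1)[OF assms(1), symmetric] refl]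
    by (intro integral_eq_nn_integral) auto
  also have "(\<integral>\<^sup>+x. ennreal (g x) \<partial>\<mu>) = (\<integral>\<^sup>+x. ennreal (g x) * indicator {0..2} x \<partial>\<mu>)"
    using MplusD(2)[OF assms(1)] by (intro nn_integral_cong) auto
  finally show ?thesis .
qed

lemma truncation_measurable:
  assumes "continuous_on {0..2} (g :: real \<Rightarrow> real)"
  shows "(\<lambda>x. ennreal (g x) * indicator {0..2} x) \<in> borel_measurable borel"
proof -
  have "(\<lambda>x. indicator {0..2} x *\<^sub>R g x) \<in> borel_measurable borel"
    using continuous_measurable[OF assms] by (subst (asm) borel_measurable_restrict_space_iff) auto
  then have "(\<lambda>x. ennreal (indicator {0..2} x *\<^sub>R g x)) \<in> borel_measurable borel" by measurable
  also have "(\<lambda>x. ennreal (indicator {0..2} x *\<^sub>R g x)) = (\<lambda>x. ennreal (g x) * indicator {0..2} x)"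
    by (auto simp: indicator_def)
  finally show ?thesis .
qed

text \<open>Testing against nonnegative functions suffices, because constants can be added to \<open>g\<close>.\<close>

lemma Mplus_eqI_nonneg:
  assumes M: "\<mu> \<in> Mplus" "\<nu> \<in> Mplus"
    and eq: "\<And>g. continuous_on {0..2} g \<Longrightarrow> (\<And>x. x \<in> {0..2} \<Longrightarrow> 0 \<le> g x) \<Longrightarrow> pairing g \<mu> = pairing g \<nu>"
  shows "\<mu> = \<nu>"
proof (rule Mplus_eqI[OF M])
  fix g :: "real \<Rightarrow> real" assume g: "continuous_on {0..2} g"
  obtain B where B: "\<And>x. x \<in> {0..2} \<Longrightarrow> \<bar>g x\<bar> \<le> B" using continuous_bounded[OF g] by blast
  have "pairing (\<lambda>_. 1) \<mu> = pairing (\<lambda>_. 1) \<nu>" by (rule eq) auto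
  then have 1: "measure \<mu> {0..2} = measure \<nu> {0..2}"
    using M MplusD by (simp add: pairing_def)
  have "pairing (\<lambda>x. g x + B) \<mu> = pairing (\<lambda>x. g x + B) \<nu>"
    using B by (intro eq continuous_intros g) (simp add: abs_le_iff minus_le_iff add.commute, smt (verit))
  then show "pairing g \<mu> = pairing g \<nu>"
    by (simp add: pairing_add_const M g 1)
qed

text \<open>\<open>opU\<close> and the measure from \<open>kernel_measure\<close> have the same
  pairings with nonnegative continuous functions, hence coincide.\<close>

lemma nn_integral_opU:
  assumes M: "\<mu> \<in> Mplus" and g: "g \<in> borel_measurable borel"
  shows "(\<integral>\<^sup>+x. g x \<partial>opU \<mu>) = (\<integral>\<^sup>+x. indicator {..1} x * dualT g x \<partial>\<mu>)"
proof -
  have id: "(\<lambda>x. x) \<in> borel_measurable \<mu>"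
    unfolding measurable_cong_sets[OF MplusD(1)[OF M] refl]
    by (intro continuous_measurable continuous_intros)
  obtain \<nu> where \<nu>: "\<nu> \<in> Mplus"
    "\<And>g. g \<in> borel_measurable borel \<Longrightarrow> (\<integral>\<^sup>+x. g x \<partial>\<nu>) = (\<integral>\<^sup>+x. indicator {..1} x * dualT g x \<partial>\<mu>)"
    by (rule kernel_measure[OF M, of "indicator {..1}"]) (auto simp: indicator_def)
  have UM: "opU \<mu> \<in> Mplus" using U_spec[OF M] by (simp add: represents_def)
  have "opU \<mu> = \<nu>"
  proof (rule Mplus_eqI_nonneg[OF UM \<nu>(1)])
    fix g :: "real \<Rightarrow> real" assume g: "continuous_on {0..2} g" "\<And>x. x \<in> {0..2} \<Longrightarrow> 0 \<le> g x"
    have "(\<lambda>x. indicator {0..2} x *\<^sub>R g x) \<in> borel_measurable borel"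
      using continuous_measurable[OF g(1)] by (subst (asm) borel_measurable_restrict_space_iff) auto
    then have gm: "(\<lambda>x. indicator {0..2} x * g x) \<in> borel_measurable borel" by simp
    \<comment> \<open>Nothing is known about \<open>g\<close> outside [0,2]. The inner indicator
      makes it Borel on the whole line and changes nothing, because 2x lies in [0,2] for x in
      [0,1].\<close>
    have "(\<lambda>x. indicator {0..1} x * (indicator {0..2} (2 * x) * g (2 * x))) \<in> borel_measurable \<mu>"
      by (rule measurable_compose[OF id, where g="\<lambda>x. indicator {0..1} x * (indicator {0..2} (2 * x) * g (2 * x))"])
         (use measurable_compose[OF _ gm] in measurable)
    also have "(\<lambda>x. indicator {0..1} x * (indicator {0..2} (2 * x) * g (2 * x))) = (\<lambda>x. indicator {0..1} x *\<^sub>R g (2 * x))"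
      by (auto simp: indicator_def)
    finally have m: "(\<lambda>x. indicator {0..1} x *\<^sub>R g (2 * x)) \<in> borel_measurable \<mu>" .
    have "pairing g (opU \<mu>) = (LINT x:{0..1}|\<mu>. g (2 * x))"
      using U_spec[OF M] g by (simp add: represents_def)
    also have "\<dots> = enn2real (\<integral>\<^sup>+x. ennreal (indicator {0..1} x *\<^sub>R g (2 * x)) \<partial>\<mu>)"
      unfolding set_lebesgue_integral_def
      using m g(2) by (intro integral_eq_nn_integral) (auto simp: indicator_def)
    also have "(\<integral>\<^sup>+x. ennreal (indicator {0..1} x *\<^sub>R g (2 * x)) \<partial>\<mu>)
        = (\<integral>\<^sup>+x. indicator {..1} x * dualT (\<lambda>x. ennreal (g x) * indicator {0..2} x) x \<partial>\<mu>)"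
      using MplusD(2)[OF M] by (intro nn_integral_cong) (auto simp: indicator_def dualT_def)
    also have "enn2real \<dots> = pairing g \<nu>"
      by (simp only: pairing_nn_integral[OF \<nu>(1) g] \<nu>(2)[OF truncation_measurable[OF g(1)]])
    finally show "pairing g (opU \<mu>) = pairing g \<nu>" .
  qed
  then show ?thesis using \<nu>(2)[OF g] by simp
qed

lemma nn_integral_opV:
  assumes M: "\<mu> \<in> Mplus" and g: "g \<in> borel_measurable borel"
  shows "(\<integral>\<^sup>+x. g x \<partial>opV \<mu>) = (\<integral>\<^sup>+x. indicator {1<..} x * dualT g x \<partial>\<mu>)"
proof -
  have id: "(\<lambda>x. x) \<in> borel_measurable \<mu>"
    unfolding measurable_cong_sets[OF MplusD(1)[OF M] refl]
    by (intro continuous_measurable continuous_intros)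
  obtain \<nu> where \<nu>: "\<nu> \<in> Mplus"
    "\<And>g. g \<in> borel_measurable borel \<Longrightarrow> (\<integral>\<^sup>+x. g x \<partial>\<nu>) = (\<integral>\<^sup>+x. indicator {1<..} x * dualT g x \<partial>\<mu>)"
    by (rule kernel_measure[OF M, of "indicator {1<..}"]) (auto simp: indicator_def)
  have VM: "opV \<mu> \<in> Mplus" using V_spec[OF M] by (simp add: represents_def)
  have "opV \<mu> = \<nu>"
  proof (rule Mplus_eqI_nonneg[OF VM \<nu>(1)])
    fix g :: "real \<Rightarrow> real" assume g: "continuous_on {0..2} g" "\<And>x. x \<in> {0..2} \<Longrightarrow> 0 \<le> g x"
    \<comment> \<open>The same cut-off for \<open>g\<close>; the bound \<open>le\<close> below keeps
      (x - 1) s inside [0,2], where \<open>G\<close> and \<open>g\<close> agree.\<close>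
    define G where "G = (\<lambda>x. indicator {0..2} x * g x)"
    obtain B where B: "\<And>x. x \<in> {0..2} \<Longrightarrow> \<bar>g x\<bar> \<le> B" using continuous_bounded[OF g(1)] by blast
    have B0: "0 \<le> B" using B[of 0] by simp
    have "(\<lambda>x. indicator {0..2} x *\<^sub>R g x) \<in> borel_measurable borel"
      using continuous_measurable[OF g(1)] by (subst (asm) borel_measurable_restrict_space_iff) auto
    then have [measurable]: "G \<in> borel_measurable borel" by (simp add: G_def)
    have G0: "0 \<le> G y" "\<bar>G y\<bar> \<le> B" for y using g(2) B B0 by (auto simp: G_def indicator_def)
    define A where "A = (\<lambda>x. indicator {1<..2} x * (LBINT s:{0..2}. G ((x - 1) * s)))"
    have "A \<in> borel_measurable borel" unfolding A_def set_lebesgue_integral_def by measurable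
    then have m: "A \<in> borel_measurable \<mu>" by (rule measurable_compose[OF id])
    have A0: "0 \<le> A x" for x
      unfolding A_def set_lebesgue_integral_def using G0
      by (intro mult_nonneg_nonneg Bochner_Integration.integral_nonneg) (auto simp: indicator_def)
    have le: "(x - 1) * s \<le> 1 * 2" if "1 < x" "x \<le> 2" "0 \<le> s" "s \<le> 2" for x s :: real
      using that by (intro mult_mono) auto
    have "pairing g (opV \<mu>) = (LINT x:{1<..2}|\<mu>. 1 / (x - 1) * (LBINT y:{0..2 * (x - 1)}. g y))"
      using V_spec[OF M] g by (simp add: represents_def)
    also have "\<dots> = (LINT x|\<mu>. A x)"
      unfolding set_lebesgue_integral_def[of \<mu>]
    proof (intro Bochner_Integration.integral_cong refl)
      fix x
      show "indicator {1<..2} x *\<^sub>R (1 / (x - 1) * (LBINT y:{0..2 * (x - 1)}. g y)) = A x"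
      proof (cases "1 < x \<and> x \<le> 2")
        case True
        have "(LBINT s:{0..2}. g ((x - 1) * s)) = (LBINT s:{0..2}. G ((x - 1) * s))"
          using True le[of x] by (intro set_lebesgue_integral_cong) (auto simp: G_def)
        then show ?thesis using True by (simp only: average_eq A_def) simp
      qed (auto simp: A_def)
    qed
    also have "\<dots> = enn2real (\<integral>\<^sup>+x. ennreal (A x) \<partial>\<mu>)"
      using m A0 by (intro integral_eq_nn_integral) auto
    also have "(\<integral>\<^sup>+x. ennreal (A x) \<partial>\<mu>)
        = (\<integral>\<^sup>+x. indicator {1<..} x * dualT (\<lambda>x. ennreal (g x) * indicator {0..2} x) x \<partial>\<mu>)"
    proof (intro nn_integral_cong)
      fix x assume "x \<in> space \<mu>"
      then have x: "x \<le> 2" using MplusD(2)[OF M] by simp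
      have int: "integrable lborel (\<lambda>s. indicator {0..2} s *\<^sub>R G ((x - 1) * s))"
        using G0 by (intro integrableI_bounded_set_indicator[where B=B]) auto
      have "(\<lambda>x. ennreal (g x) * indicator {0..2} x) = (\<lambda>x. ennreal (G x))"
        by (auto simp: G_def indicator_def)
      moreover have "ennreal (LBINT s:{0..2}. G ((x - 1) * s))
          = (\<integral>\<^sup>+s. ennreal (G ((x - 1) * s)) * indicator {0..2} s \<partial>lborel)"
        unfolding set_lebesgue_integral_def
        by (subst nn_integral_eq_integral[OF int, symmetric]) (auto simp: G0 indicator_def intro!: nn_integral_cong)
      ultimately show "ennreal (A x) = indicator {1<..} x * dualT (\<lambda>x. ennreal (g x) * indicator {0..2} x) x"
        using x by (auto simp: A_def dualT_def indicator_def)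
    qed
    also have "enn2real \<dots> = pairing g \<nu>"
      by (simp only: pairing_nn_integral[OF \<nu>(1) g] \<nu>(2)[OF truncation_measurable[OF g(1)]])
    finally show "pairing g (opV \<mu>) = pairing g \<nu>" .
  qed
  then show ?thesis using \<nu>(2)[OF g] by simp
qed

text \<open>\<open>opT\<close> is built from a set function, so additivity is available on sets only
  and has to be carried to integrals by induction on Borel functions.\<close>

lemma nn_integral_opT_eq_add:
  assumes M: "\<mu> \<in> Mplus" and "g \<in> borel_measurable I02"
  shows "(\<integral>\<^sup>+x. g x \<partial>opT \<mu>) = (\<integral>\<^sup>+x. g x \<partial>opU \<mu>) + (\<integral>\<^sup>+x. g x \<partial>opV \<mu>)"
proof -
  have UM: "opU \<mu> \<in> Mplus" using U_spec[OF M] by (simp add: represents_def)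
  have VM: "opV \<mu> \<in> Mplus" using V_spec[OF M] by (simp add: represents_def)
  note [measurable_cong] = MplusD(1)[OF UM] MplusD(1)[OF VM] sets_T
  have sp: "space I02 = {0..2}" by (simp add: space_restrict_space)
  show ?thesis using assms(2)
  proof (induction rule: borel_measurable_induct)
    case (cong f g)
    have "(\<integral>\<^sup>+x. f x \<partial>\<rho>) = (\<integral>\<^sup>+x. g x \<partial>\<rho>)" if "space \<rho> = {0..2}" for \<rho>
      using that cong by (intro nn_integral_cong) (auto simp: sp)
    then show ?case using cong MplusD(2)[OF UM] MplusD(2)[OF VM] by simp
  next
    case (set A)
    then show ?case using emeasure_T[OF M] MplusD(1)[OF UM] MplusD(1)[OF VM] by simp
  next
    case (mult u c)
    note [measurable] = mult(2)
    show ?case using mult by (simp add: nn_integral_cmult distrib_left)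
  next
    case (add u v)
    note [measurable] = add(1,3)
    show ?case using add by (simp add: nn_integral_add ac_simps)
  next
    case (seq U)
    note [measurable] = seq(1)
    show ?case unfolding SUP_apply using seq
      by (simp add: nn_integral_monotone_convergence_SUP incseq_nn_integral
          ennreal_SUP_add[symmetric])
  qed
qed

lemma nn_integral_opT:
  assumes M: "\<mu> \<in> Mplus" and g: "g \<in> borel_measurable borel"
  shows "(\<integral>\<^sup>+x. g x \<partial>opT \<mu>) = (\<integral>\<^sup>+x. dualT g x \<partial>\<mu>)"
proof -
  note [measurable_cong] = MplusD(1)[OF M]
  have [measurable]: "dualT g \<in> borel_measurable I02"
    using g by (intro measurable_restrict_space1) simp
  have [measurable]: "indicator {..1} \<in> borel_measurable I02" "indicator {1<..} \<in> borel_measurable I02"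
    by (intro measurable_restrict_space1; simp)+
  have "(\<integral>\<^sup>+x. g x \<partial>opT \<mu>)
      = (\<integral>\<^sup>+x. indicator {..1} x * dualT g x + indicator {1<..} x * dualT g x \<partial>\<mu>)"
    using g by (subst nn_integral_add)
      (auto simp: nn_integral_opT_eq_add M measurable_restrict_space1 nn_integral_opU nn_integral_opV)
  also have "\<dots> = (\<integral>\<^sup>+x. dualT g x \<partial>\<mu>)"
    by (intro nn_integral_cong) (auto simp: indicator_def)
  finally show ?thesis .
qed

section \<open>Iterates of the normalised operator as quotients\<close>

lemma dualT_ge_1: "(\<And>x. 1 \<le> g x) \<Longrightarrow> 1 \<le> dualT g x"
proof -
  assume g: "\<And>x. 1 \<le> g x"
  have "1 \<le> dualT (\<lambda>_. 1) x" by (auto simp: dualT_def)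
  also have "\<dots> \<le> dualT g x" by (rule dualT_mono) (rule g)
  finally show ?thesis .
qed

lemma dualT_funpow_1_ge_1: "1 \<le> (dualT ^^ n) (\<lambda>_. 1) x"
  by (induction n arbitrary: x) (auto intro: dualT_ge_1)

lemma nn_integral_That:
  assumes M: "\<mu> \<in> Mplus" "measure \<mu> {0..2} \<noteq> 0" and g: "g \<in> borel_measurable borel"
  shows "(\<integral>\<^sup>+x. g x \<partial>That \<mu>) = (\<integral>\<^sup>+x. dualT g x \<partial>\<mu>) / (\<integral>\<^sup>+x. dualT (\<lambda>_. 1) x \<partial>\<mu>)"
proof -
  interpret t: finite_measure "opT \<mu>" using MplusD[OF T_Mplus[OF M(1)]] by simp
  have gT: "g \<in> borel_measurable (opT \<mu>)"
    unfolding measurable_cong_sets[OF sets_T refl] using g by (rule measurable_restrict_space1)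
  have "(\<integral>\<^sup>+x. dualT (\<lambda>_. 1) x \<partial>\<mu>) = emeasure (opT \<mu>) {0..2}"
    using nn_integral_opT[OF M(1), of "\<lambda>_. 1"] by simp
  also have "\<dots> = ennreal (measure (opT \<mu>) {0..2})" by (simp add: t.emeasure_eq_measure)
  finally have 1: "(\<integral>\<^sup>+x. dualT (\<lambda>_. 1) x \<partial>\<mu>) = ennreal (measure (opT \<mu>) {0..2})" .
  have "(\<integral>\<^sup>+x. g x \<partial>That \<mu>) = ennreal (1 / measure (opT \<mu>) {0..2}) * (\<integral>\<^sup>+x. dualT g x \<partial>\<mu>)"
    unfolding That_def by (simp add: nn_integral_scale_measure[OF gT] nn_integral_opT[OF M(1) g])
  also have "ennreal (1 / measure (opT \<mu>) {0..2}) = inverse (ennreal (measure (opT \<mu>) {0..2}))"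
    using T_mass_pos[OF M] by (simp add: inverse_ennreal inverse_eq_divide)
  finally show ?thesis unfolding 1 by (simp add: divide_ennreal_def mult.commute)
qed

text \<open>\<open>dualT\<close> multiplies a constant by 1 or by 2, so the iterates of 1 are at
  most 2^n. With the lower bound 1 this makes every cancellation of normalising factors legitimate
  in \<open>ennreal\<close>.\<close>

lemma dualT_funpow_1_finite: "(dualT ^^ n) (\<lambda>_. 1) x < \<infinity>"
proof -
  have "(dualT ^^ n) (\<lambda>_. 1) x \<le> ennreal (2 ^ n)" for n x
  proof (induction n arbitrary: x)
    case (Suc n)
    have "dualT ((dualT ^^ n) (\<lambda>_. 1)) x \<le> dualT (\<lambda>_. ennreal (2 ^ n)) x"
      by (rule dualT_mono) (rule Suc)
    also have "\<dots> \<le> ennreal (2 ^ n) * 2"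
      by (auto simp: dualT_def nn_integral_cmult intro: order_trans[OF _ mult_left_mono[of 1 2]])
    also have "\<dots> = ennreal (2 ^ Suc n)" by (simp add: ennreal_mult mult.commute)
    finally show ?case by simp
  qed simp
  from this[of n x] show ?thesis using order_le_less_trans by fastforce
qed

lemma ennreal_divide_divide_cancel:
  fixes a b d :: ennreal
  assumes "d \<noteq> 0" "d \<noteq> \<infinity>" "b \<noteq> 0" "b \<noteq> \<infinity>"
  shows "(a / d) / (b / d) = a / b"
proof -
  obtain r where r: "d = ennreal r" "0 < r" using assms by (cases d) (auto simp: order_le_less)
  obtain s where s: "b = ennreal s" "0 < s" using assms by (cases b) (auto simp: order_le_less)
  have "(a / d) / (b / d) = a * (ennreal (1 / r) * ennreal (r / s))"
    using r s by (simp add: divide_ennreal_def inverse_ennreal inverse_eq_divide divide_ennreal mult.assoc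
        flip: ennreal_mult)
  also have "\<dots> = a / b"
    using r s by (simp add: divide_ennreal_def inverse_ennreal inverse_eq_divide flip: ennreal_mult)
  finally show ?thesis .
qed

text \<open>The normalising constants telescope: each step divides by the integral of
  \<open>dualT 1\<close>, which the induction hypothesis turns into a quotient of consecutive
  iterates of 1. The induction is over all \<open>g\<close>, since the step uses the hypothesis for
  \<open>dualT g\<close> and for \<open>dualT 1\<close>.\<close>

lemma That_iterate:
  assumes x: "0 \<le> x" "x \<le> 2" and g: "g \<in> borel_measurable borel"
  shows "(\<integral>\<^sup>+y. g y \<partial>(That ^^ n) (return I02 x)) = (dualT ^^ n) g x / (dualT ^^ n) (\<lambda>_. 1) x"
  using g
proof (induction n arbitrary: g)
  case 0
  have "x \<in> space I02" using x by (simp add: space_restrict_space)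
  then show ?case using 0 by (simp add: nn_integral_return measurable_restrict_space1 divide_ennreal_def)
next
  case (Suc n)
  let ?\<mu> = "(That ^^ n) (return I02 x)" and ?d = "(dualT ^^ n) (\<lambda>_. 1) x"
  have P: "?\<mu> \<in> Mplus" "prob_space ?\<mu>" using That_iterate_prob[OF x] by auto
  then have m: "measure ?\<mu> {0..2} \<noteq> 0"
    using prob_space.prob_space[OF P(2)] MplusD(2)[OF P(1)] by simp
  have d: "?d \<noteq> 0" "?d \<noteq> \<infinity>"
    using dualT_funpow_1_ge_1[of n x] dualT_funpow_1_finite[of n x] by (auto simp: less_top)
  have e: "(dualT ^^ Suc n) (\<lambda>_. 1) x \<noteq> 0" "(dualT ^^ Suc n) (\<lambda>_. 1) x \<noteq> \<infinity>"
    using dualT_funpow_1_ge_1[of "Suc n" x] dualT_funpow_1_finite[of "Suc n" x]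
    by (auto simp: less_top simp del: funpow.simps)
  have sw: "(dualT ^^ n) (dualT h) = (dualT ^^ Suc n) h" for h by (simp add: funpow_swap1)
  have "(\<integral>\<^sup>+y. g y \<partial>That ?\<mu>) = (\<integral>\<^sup>+y. dualT g y \<partial>?\<mu>) / (\<integral>\<^sup>+y. dualT (\<lambda>_. 1) y \<partial>?\<mu>)"
    by (rule nn_integral_That[OF P(1) m Suc.prems])
  also have "\<dots> = ((dualT ^^ Suc n) g x / ?d) / ((dualT ^^ Suc n) (\<lambda>_. 1) x / ?d)"
    using Suc.prems by (simp add: Suc.IH sw del: funpow.simps)
  also have "\<dots> = (dualT ^^ Suc n) g x / (dualT ^^ Suc n) (\<lambda>_. 1) x"
    by (rule ennreal_divide_divide_cancel[OF d e])
  finally show ?case by simp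
qed

section \<open>The stationary density\<close>

locale fstar =
  fixes f :: "real \<Rightarrow> real"
  assumes is_fstar: "is_fstar f"
begin

definition lam :: real where "lam = 1 + upper_mass f"

text \<open>The cut-off removes the values of \<open>f\<close> outside (0,2], about which
  \<open>is_fstar\<close> says nothing.\<close>

definition dens :: "real \<Rightarrow> ennreal" where
  "dens t = ennreal (f t) * indicator {0<..2} t"

definition F :: "(real \<Rightarrow> ennreal) \<Rightarrow> ennreal" where
  "F g = (\<integral>\<^sup>+t. dens t * g t \<partial>lborel)"

lemma f_nonneg: "0 < t \<Longrightarrow> t \<le> 2 \<Longrightarrow> 0 \<le> f t"
  and f_integrable: "set_integrable lborel {0<..2} f"
  and f_total: "(LBINT t:{0<..2}. f t) = 1"
  and f_eq: "0 < x \<Longrightarrow> x \<le> 2 \<Longrightarrow>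
    lam * f x = 1 / 2 * f (x / 2) + (LBINT y:{1 + x / 2..2}. f y / (y - 1))"
  using is_fstar by (auto simp: is_fstar_def prob_density_def lam_def)

text \<open>On (0,2] one has |t - 1| <= 1, so the k-th term of the series is dominated by |a k|.
  This gives both the bound and, by uniform convergence, continuity.\<close>

lemma f_log_bound: "\<exists>l\<ge>0. \<exists>A\<ge>0. \<forall>t. 0 < t \<and> t \<le> 2 \<longrightarrow> f t \<le> l * \<bar>ln t\<bar> + A"
  and f_continuous: "continuous_on {0<..2} f"
proof -
  obtain l :: real and a :: "nat \<Rightarrow> real" where s: "summable (\<lambda>k. \<bar>a k\<bar>)"
    and f: "\<And>t. t \<in> {0<..2} \<Longrightarrow> f t = l * ln t + (\<Sum>k. a k * (t - 1) ^ k)"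
    using is_fstar unfolding is_fstar_def log_series_form_def by blast
  have le: "norm (a k * (t - 1) ^ k) \<le> \<bar>a k\<bar>" if "t \<in> {0<..2}" for t k
  proof -
    have "\<bar>t - 1\<bar> ^ k \<le> 1" using that by (intro power_le_one) auto
    then show ?thesis by (simp add: abs_mult power_abs mult_left_le)
  qed
  have sn: "summable (\<lambda>k. norm (a k * (t - 1) ^ k))" if "t \<in> {0<..2}" for t
    by (rule summable_comparison_test[OF _ s]) (use le[OF that] in auto)
  have "f t \<le> \<bar>l\<bar> * \<bar>ln t\<bar> + (\<Sum>k. \<bar>a k\<bar>)" if t: "0 < t" "t \<le> 2" for t
  proof -
    have t': "t \<in> {0<..2}" using t by simp
    have "(\<Sum>k. a k * (t - 1) ^ k) \<le> (\<Sum>k. \<bar>a k\<bar>)"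
      using le[OF t'] summable_norm_cancel[OF sn[OF t']] s
      by (intro suminf_le) (auto intro: order_trans[OF abs_ge_self])
    moreover have "l * ln t \<le> \<bar>l\<bar> * \<bar>ln t\<bar>" by (metis abs_ge_self abs_mult)
    ultimately show ?thesis using f[OF t'] by linarith
  qed
  moreover have "0 \<le> (\<Sum>k. \<bar>a k\<bar>)" by (rule suminf_nonneg[OF s]) simp
  ultimately show "\<exists>l\<ge>0. \<exists>A\<ge>0. \<forall>t. 0 < t \<and> t \<le> 2 \<longrightarrow> f t \<le> l * \<bar>ln t\<bar> + A"
    by (metis abs_ge_zero)
  have "uniform_limit {0<..2} (\<lambda>n t. \<Sum>k<n. a k * (t - 1) ^ k) (\<lambda>t. \<Sum>k. a k * (t - 1) ^ k) sequentially"
    by (rule Weierstrass_m_test[OF le s])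
  then have "continuous_on {0<..2} (\<lambda>t. \<Sum>k. a k * (t - 1) ^ k)"
    by (rule uniform_limit_theorem[rotated]) (auto intro!: always_eventually continuous_intros)
  then have "continuous_on {0<..2} (\<lambda>t. l * ln t + (\<Sum>k. a k * (t - 1) ^ k))"
    by (intro continuous_intros) auto
  then show "continuous_on {0<..2} f" by (rule continuous_on_eq) (simp add: f)
qed

lemma kernel_integrable: "0 < x \<Longrightarrow> set_integrable lborel {1 + x / 2..2} (\<lambda>y. f y / (y - 1))"
  by (intro borel_integrable_atLeastAtMost' continuous_intros continuous_on_subset[OF f_continuous]) auto

lemma kernel_nonneg: "0 < x \<Longrightarrow> 0 \<le> (LBINT y:{1 + x / 2..2}. f y / (y - 1))"
  unfolding set_lebesgue_integral_def
  by (intro Bochner_Integration.integral_nonneg) (auto simp: indicator_def f_nonneg)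

lemma upper_mass_nonneg: "0 \<le> upper_mass f"
  unfolding set_lebesgue_integral_def upper_mass_def
  by (intro Bochner_Integration.integral_nonneg) (auto simp: indicator_def f_nonneg)

lemma lam_pos: "0 < lam"
  using upper_mass_nonneg by (simp add: lam_def)

section \<open>Positivity of the stationary density\<close>

text \<open>At a zero of \<open>f\<close> the two nonnegative terms on the right of
  \<open>f_eq\<close> must both vanish. The integrand of the second is continuous and nonnegative,
  hence zero throughout the interval; t < 2 makes that interval nondegenerate.\<close>

lemma zero_propagates:
  assumes "0 < t" "t \<le> 2" "f t = 0"
  shows "f (t / 2) = 0" "t < 2 \<Longrightarrow> y \<in> {1 + t / 2..2} \<Longrightarrow> f y = 0"
proof -
  have "0 \<le> f (t / 2)" using assms by (intro f_nonneg) auto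
  then have *: "f (t / 2) = 0" "(LBINT y:{1 + t / 2..2}. f y / (y - 1)) = 0"
    using f_eq[OF assms(1,2)] kernel_nonneg[OF assms(1)] assms(3) by auto
  show "f (t / 2) = 0" by fact
  assume "t < 2" and y: "y \<in> {1 + t / 2..2}"
  have "((\<lambda>y. f y / (y - 1)) has_integral 0) (cbox (1 + t / 2) 2)"
    using set_borel_integral_eq_integral[OF kernel_integrable[OF assms(1)]] *(2)
    by (metis cbox_interval integrable_integral)
  then have "f y / (y - 1) = 0"
    by (rule has_integral_0_cbox_imp_0[rotated 2])
       (use \<open>t < 2\<close> y \<open>0 < t\<close> in \<open>auto intro!: continuous_intros continuous_on_subset[OF f_continuous] f_nonneg divide_nonneg_nonneg\<close>)
  then show "f y = 0" using y \<open>0 < t\<close> by auto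
qed

text \<open>A single zero would spread over all of (0,2], against total mass 1: halving drives it
  towards 0, the integral term then clears (1,2], and halving again clears the rest.\<close>

lemma f_pos:
  assumes "0 < t" "t \<le> 2"
  shows "0 < f t"
proof (rule ccontr)
  assume "\<not> 0 < f t"
  then have t0: "f t = 0" using f_nonneg[OF assms] by simp
  have half: "f (t / 2 ^ k) = 0" for k
  proof (induction k)
    case (Suc k)
    have "t / 2 ^ k \<le> t / 1" using assms by (intro divide_left_mono) auto
    then have "f (t / 2 ^ k / 2) = 0" using assms Suc by (intro zero_propagates(1)) auto
    then show ?case by (simp add: mult.commute)
  qed (use t0 in simp)
  \<comment> \<open>The zeros t / 2^k tend to 0, so the intervals [1 + t / 2^(k+1), 2] exhaust
    (1,2].\<close>
  have up: "f y = 0" if "1 < y" "y \<le> 2" for y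
  proof -
    obtain k where k: "t / (y - 1) < 2 ^ k" using real_arch_pow[of 2] by auto
    have "t / (y - 1) < 2 ^ Suc k" using k by (simp add: less_le_trans[OF k])
    then have "t / 2 ^ Suc k < y - 1" using that assms by (simp add: field_simps)
    moreover have "t / 2 ^ Suc k < 2"
      using assms calculation that by linarith
    ultimately show ?thesis
      using zero_propagates(2)[of "t / 2 ^ Suc k" y] half[of "Suc k"] assms that
      by (auto simp del: power_Suc)
  qed
  \<comment> \<open>Dyadic descent: a zero at 2x gives a zero at x, starting from (1,2].\<close>
  have "f x = 0" if "2 / 2 ^ k < x" "x \<le> 2" for x k
    using that
  proof (induction k arbitrary: x)
    case (Suc k)
    show ?case
    proof (cases "x \<le> 1")
      case True
      have "0 < 2 / (2::real) ^ Suc k" by simp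
      then have x: "0 < x" using Suc.prems by linarith
      have "f (2 * x) = 0" using Suc True by (intro Suc.IH) (auto simp: field_simps)
      then have "f (2 * x / 2) = 0" using x True by (intro zero_propagates(1)) auto
      then show ?thesis by simp
    qed (use up Suc in auto)
  qed auto
  then have z: "f x = 0" if "0 < x" "x \<le> 2" for x
  proof -
    obtain k where k: "2 / x < 2 ^ k" using real_arch_pow[of 2] by auto
    then have "2 / 2 ^ k < x" using that by (simp add: field_simps)
    then show ?thesis using \<open>\<And>x k. 2 / 2 ^ k < x \<Longrightarrow> x \<le> 2 \<Longrightarrow> f x = 0\<close> that by blast
  qed
  have "(LBINT t:{0<..2}. f t) = (LBINT t:{0<..2::real}. 0)"
    by (intro set_lebesgue_integral_cong) (auto simp: z)
  then show False using f_total by simp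
qed

text \<open>Compactness gives a positive minimum f(z) on [1,2] but nothing near 0. For t <= 1 the
  integral in \<open>f_eq\<close> runs over an interval containing [3/2,2], where the integrand is
  at least f(z); its length 1/2 explains the bound f(z) / (2 lam).\<close>

lemma f_lower_bound: obtains m where "0 < m" "\<And>t. 0 < t \<Longrightarrow> t \<le> 2 \<Longrightarrow> m \<le> f t"
proof -
  have c: "continuous_on {1..2} f" by (rule continuous_on_subset[OF f_continuous]) auto
  obtain z where z: "z \<in> {1..2}" "\<And>y. y \<in> {1..2} \<Longrightarrow> f z \<le> f y"
    using continuous_attains_inf[OF _ _ c] by auto
  define m where "m = min (f z) (f z / (2 * lam))"
  have fz: "0 < f z" using z by (intro f_pos) auto
  have "m \<le> f t" if t: "0 < t" "t \<le> 2" for t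
  proof (cases "t \<le> 1")
    case True
    have "f z / 2 = (LBINT y:{3/2..2::real}. f z)" by (simp add: set_integral_const)
    also have "\<dots> = (LBINT y. indicator {3/2..2::real} y *\<^sub>R f z)" by (simp add: set_lebesgue_integral_def)
    also have "\<dots> \<le> (LBINT y. indicator {1 + t / 2..2} y *\<^sub>R (f y / (y - 1)))"
    proof (rule integral_mono)
      show "integrable lborel (\<lambda>y. indicator {3/2..2::real} y *\<^sub>R f z)"
        using borel_integrable_atLeastAtMost'[of "3/2" 2 "\<lambda>_. f z", OF continuous_on_const]
        unfolding set_integrable_def .
      show "integrable lborel (\<lambda>y. indicator {1 + t / 2..2} y *\<^sub>R (f y / (y - 1)))"
        using kernel_integrable[OF t(1)] by (simp add: set_integrable_def)
      fix y :: real
      show "indicator {3/2..2} y *\<^sub>R f z \<le> indicator {1 + t / 2..2} y *\<^sub>R (f y / (y - 1))"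
      proof (cases "3/2 \<le> y \<and> y \<le> 2")
        case y: True
        have "f z * (y - 1) \<le> f y * 1" using y z(2)[of y] f_nonneg[of y] by (intro mult_mono) simp_all
        then have "f z \<le> f y / (y - 1)" using y by (simp add: field_simps)
        then show ?thesis using y True by auto
      next
        case False
        then show ?thesis using t by (auto simp: indicator_def f_nonneg)
      qed
    qed
    also have "\<dots> = (LBINT y:{1 + t / 2..2}. f y / (y - 1))" by (simp add: set_lebesgue_integral_def)
    also have "\<dots> \<le> lam * f t" using f_eq[OF t] f_nonneg[of "t / 2"] t by simp
    finally have "f z / (2 * lam) \<le> f t" using lam_pos by (simp add: field_simps)
    then show ?thesis by (simp add: m_def)
  qed (use z(2)[of t] t in \<open>auto simp: m_def\<close>)
  moreover have "0 < m" using fz lam_pos by (simp add: m_def)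
  ultimately show ?thesis using that by blast
qed

lemma dens_measurable [measurable]: "dens \<in> borel_measurable borel"
proof -
  have "(\<lambda>x. indicator {0<..2} x *\<^sub>R f x) \<in> borel_measurable borel"
    using f_integrable by (simp add: set_integrable_def integrable_iff_bounded)
  then have "(\<lambda>x. ennreal (indicator {0<..2} x *\<^sub>R f x)) \<in> borel_measurable borel" by measurable
  also have "(\<lambda>x. ennreal (indicator {0<..2} x *\<^sub>R f x)) = dens"
    by (auto simp: dens_def indicator_def)
  finally show ?thesis .
qed

lemma F_one: "F (\<lambda>_. 1) = 1"
proof -
  have i: "integrable lborel (\<lambda>x. indicator {0<..2} x *\<^sub>R f x)"
    using f_integrable by (simp add: set_integrable_def)
  have "F (\<lambda>_. 1) = (\<integral>\<^sup>+t. ennreal (indicator {0<..2} t *\<^sub>R f t) \<partial>lborel)"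
    unfolding F_def dens_def by (intro nn_integral_cong) (auto simp: indicator_def)
  also have "\<dots> = ennreal (LBINT t. indicator {0<..2} t *\<^sub>R f t)"
    by (rule nn_integral_eq_integral[OF i]) (auto simp: indicator_def f_nonneg)
  finally show ?thesis using f_total by (simp add: set_lebesgue_integral_def)
qed

lemma F_add_scaled:
  "g \<in> borel_measurable borel \<Longrightarrow> h \<in> borel_measurable borel \<Longrightarrow>
    F (\<lambda>x. c * g x + h x) = c * F g + F h"
  unfolding F_def by (simp add: nn_integral_add distrib_left mult.left_commute nn_integral_cmult)

text \<open>\<open>dualT_duality\<close> with weight \<open>dens\<close> moves the operator onto the
  density, where the claim becomes \<open>f_eq\<close> pointwise.\<close>

lemma F_dualT:
  assumes [measurable]: "g \<in> borel_measurable borel"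
  shows "F (dualT g) = ennreal lam * F g"
proof -
  have AE0: "AE y in lborel. y \<noteq> (0::real)" by (rule AE_lborel_singleton)
  have k: "(\<integral>\<^sup>+t. dens t * ennreal (1 / (t - 1)) * indicator {t. 1 < t \<and> 0 \<le> y \<and> y \<le> 2 * (t - 1)} t \<partial>lborel)
      = ennreal (LBINT t:{1 + y / 2..2}. f t / (t - 1))" if y: "0 < y" for y
  proof -
    have "(\<integral>\<^sup>+t. dens t * ennreal (1 / (t - 1)) * indicator {t. 1 < t \<and> 0 \<le> y \<and> y \<le> 2 * (t - 1)} t \<partial>lborel)
        = (\<integral>\<^sup>+t. ennreal (indicator {1 + y / 2..2} t *\<^sub>R (f t / (t - 1))) \<partial>lborel)"
      using y by (intro nn_integral_cong)
        (auto simp: dens_def indicator_def f_nonneg field_simps simp flip: ennreal_mult)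
    also have "\<dots> = ennreal (LBINT t:{1 + y / 2..2}. f t / (t - 1))"
      unfolding set_lebesgue_integral_def
      using kernel_integrable[OF y] y
      by (intro nn_integral_eq_integral) (auto simp: set_integrable_def indicator_def f_nonneg)
    finally show ?thesis .
  qed
  have "F (dualT g) = (\<integral>\<^sup>+y. g y * (ennreal (1 / 2) * dens (y / 2) * indicator {..2} y
        + (\<integral>\<^sup>+t. dens t * ennreal (1 / (t - 1)) * indicator {t. 1 < t \<and> 0 \<le> y \<and> y \<le> 2 * (t - 1)} t \<partial>lborel)) \<partial>lborel)"
    unfolding F_def by (rule dualT_duality) auto
  also have "\<dots> = (\<integral>\<^sup>+y. ennreal lam * (dens y * g y) \<partial>lborel)"
  \<comment> \<open>The point y = 0 is left out: \<open>dens\<close> vanishes there, while the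
    kernel integral need not.\<close>
  proof (rule nn_integral_cong_AE, use AE0 in eventually_elim)
    fix y :: real assume "y \<noteq> 0"
    then consider "y < 0" | "0 < y" "y \<le> 2" | "2 < y" by linarith
    then show "g y * (ennreal (1 / 2) * dens (y / 2) * indicator {..2} y
        + (\<integral>\<^sup>+t. dens t * ennreal (1 / (t - 1)) * indicator {t. 1 < t \<and> 0 \<le> y \<and> y \<le> 2 * (t - 1)} t \<partial>lborel))
        = ennreal lam * (dens y * g y)"
    proof cases
      case 1
      then show ?thesis by (simp add: dens_def)
    next
      case 2
      have "ennreal (1 / 2) * dens (y / 2) * indicator {..2} y + ennreal (LBINT t:{1 + y / 2..2}. f t / (t - 1))
          = ennreal (1 / 2 * f (y / 2)) + ennreal (LBINT t:{1 + y / 2..2}. f t / (t - 1))"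
        using 2 f_nonneg[of "y / 2"] by (simp add: dens_def ennreal_mult del: times_divide_eq_left)
      also have "\<dots> = ennreal (lam * f y)"
        using 2 f_nonneg[of "y / 2"] kernel_nonneg[OF 2(1)] unfolding f_eq[OF 2]
        by (intro ennreal_plus[symmetric]) auto
      also have "\<dots> = ennreal lam * dens y"
        using 2 lam_pos by (simp add: dens_def ennreal_mult')
      finally show ?thesis using k[OF 2(1)] by (simp add: ac_simps)
    next
      case 3
      have "(LBINT t:{1 + y / 2..2}. f t / (t - 1)) = 0"
        using 3 by (simp add: set_lebesgue_integral_def)
      then show ?thesis using 3 k[of y] by (simp add: dens_def)
    qed
  qed
  also have "\<dots> = ennreal lam * F g" unfolding F_def by (rule nn_integral_cmult) simp
  finally show ?thesis .
qed

subsection \<open>The Doeblin bound and contraction\<close>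

text \<open>For x > 7/4 the averaging interval [0, 2(x - 1)] contains [0,3/2]. Reaching beyond 1
  matters: the part (1,3/2] is where the inner averages produce the logarithm.\<close>

definition J :: "real \<Rightarrow> ennreal" where "J = indicator {7 / 4<..<2}"

lemma J_measurable [measurable]: "J \<in> borel_measurable borel"
  by (simp add: J_def)

text \<open>For x in the support of \<open>J\<close> the outer average is at least the integral of
  \<open>dualT g\<close> over [0,3/2]. By duality this is an integral of g against a kernel that is
  at least 1/2 on (0,2], from doubling, and has the further term -ln y on (0,1], from averaging.
  Such a kernel dominates a multiple of any density with a logarithmic singularity.\<close>

lemma minorization:
  obtains e where "0 < e"
    "\<And>g x. g \<in> borel_measurable borel \<Longrightarrow> ennreal e * F g * J x \<le> dualT (dualT g) x"
proof -
  obtain l A where lA: "0 \<le> l" "0 \<le> A" "\<And>t. 0 < t \<Longrightarrow> t \<le> 2 \<Longrightarrow> f t \<le> l * \<bar>ln t\<bar> + A"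
    using f_log_bound by auto
  \<comment> \<open>Chosen so that the three bounds in the next line hold; the summand 1 keeps the
    denominator positive when \<open>l\<close> and \<open>A\<close> are both 0.\<close>
  define e where "e = 1 / (2 * (l + A + 1))"
  have e: "0 < e" "e * l \<le> 1" "e * A \<le> 1 / 2" "e * (l + A) \<le> 1 / 2"
    using lA(1,2) by (auto simp: e_def field_simps)
  let ?k = "\<lambda>y t. indicator {0..3 / 2} t * ennreal (1 / (t - 1)) *
    indicator {t. 1 < t \<and> 0 \<le> y \<and> y \<le> 2 * (t - 1)} t :: ennreal"
  have log: "(\<integral>\<^sup>+t. ?k y t \<partial>lborel) = ennreal (- ln y)" if y: "0 < y" "y \<le> 1" for y
  proof -
    have "(\<integral>\<^sup>+t. ?k y t \<partial>lborel) = (\<integral>\<^sup>+t. ennreal (1 / (t - 1)) * indicator {1 + y / 2..3 / 2} t \<partial>lborel)"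
      using y by (intro nn_integral_cong) (auto simp: indicator_def)
    also have "\<dots> = ennreal (ln (3 / 2 - 1) - ln (1 + y / 2 - 1))"
      using y by (intro nn_integral_FTC_Icc) (auto intro!: derivative_eq_intros)
    also have "ln (3 / 2 - 1) - ln (1 + y / 2 - 1) = - ln y"
      using y by (simp add: ln_div)
    finally show ?thesis .
  qed
  \<comment> \<open>On (0,1] the logarithm absorbs l |ln y| and the constant 1/2 absorbs A. On (1,2]
    the integral is dropped, and 1/2 suffices because |ln y| <= 1.\<close>
  have kernel: "ennreal e * dens y \<le> ennreal (1 / 2) * indicator {0..3 / 2} (y / 2) * indicator {..2} y + (\<integral>\<^sup>+t. ?k y t \<partial>lborel)" for y
  proof -
    consider "y \<le> 0 \<or> 2 < y" | "0 < y" "y \<le> 1" | "1 < y" "y \<le> 2" by linarith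
    then show ?thesis
    proof cases
      case 2
      have "e * f y \<le> e * (l * \<bar>ln y\<bar> + A)" using lA(3)[of y] e(1) 2 by (intro mult_left_mono) auto
      also have "\<dots> = e * l * (- ln y) + e * A" using 2 by (simp add: algebra_simps)
      also have "\<dots> \<le> 1 * (- ln y) + 1 / 2" using e 2 by (intro add_mono mult_right_mono) auto
      finally have "e * f y \<le> 1 / 2 + - ln y" by simp
      then have "ennreal (e * f y) \<le> ennreal (1 / 2) + ennreal (- ln y)"
        using 2 by (subst ennreal_plus[symmetric]) (auto intro: ennreal_leI)
      then show ?thesis unfolding log[OF 2] using 2 e(1) f_nonneg[of y]
        by (simp add: dens_def ennreal_mult del: times_divide_eq_left)
    next
      case 3
      have "0 < ln y" "ln y \<le> 1" using 3 ln_le_minus_one[of y] by (auto simp del: ln_le_minus_one)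
      have "e * f y \<le> e * (l * \<bar>ln y\<bar> + A)" using lA(3)[of y] e(1) 3 by (intro mult_left_mono) auto
      also have "\<dots> \<le> e * (l * 1 + A)" using e(1) lA \<open>0 < ln y\<close> \<open>ln y \<le> 1\<close>
        by (intro mult_left_mono add_right_mono) auto
      also have "\<dots> \<le> 1 / 2" using e by simp
      finally have "ennreal (e * f y) \<le> ennreal (1 / 2)" by (rule ennreal_leI)
      then have "ennreal e * dens y \<le> ennreal (1 / 2) * indicator {0..3 / 2} (y / 2) * indicator {..2} y"
        using 3 e(1) f_nonneg[of y] by (simp add: dens_def ennreal_mult del: times_divide_eq_left)
      then show ?thesis by (rule order_trans) simp
    qed (auto simp: dens_def)
  qed
  have "ennreal e * F g * J x \<le> dualT (dualT g) x" if [measurable]: "g \<in> borel_measurable borel" for g x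
  proof (cases "7 / 4 < x \<and> x < 2")
    case True
    have "ennreal e * F g = (\<integral>\<^sup>+y. g y * (ennreal e * dens y) \<partial>lborel)"
      unfolding F_def by (subst nn_integral_cmult[symmetric]) (auto simp: ac_simps)
    also have "\<dots> \<le> (\<integral>\<^sup>+y. g y * (ennreal (1 / 2) * indicator {0..3 / 2} (y / 2) * indicator {..2} y
        + (\<integral>\<^sup>+t. ?k y t \<partial>lborel)) \<partial>lborel)"
      using kernel by (intro nn_integral_mono mult_left_mono) auto
    also have "\<dots> = (\<integral>\<^sup>+y. indicator {0..3 / 2} y * dualT g y \<partial>lborel)"
      by (rule dualT_duality[symmetric]) auto
    also have "\<dots> \<le> (\<integral>\<^sup>+y. dualT g y * indicator {0..2 * (x - 1)} y \<partial>lborel)"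
      using True by (intro nn_integral_mono) (auto simp: indicator_def)
    also have "\<dots> = 1 * \<dots>" by simp
    also have "\<dots> \<le> ennreal (1 / (x - 1)) * (\<integral>\<^sup>+y. dualT g y * indicator {0..2 * (x - 1)} y \<partial>lborel)"
      using True ennreal_leI[of 1 "1 / (x - 1)"] by (intro mult_right_mono) auto
    also have "\<dots> = dualT (dualT g) x" using True by (intro dualT_average[symmetric]) auto
    finally show ?thesis using True by (simp add: J_def)
  qed (auto simp: J_def indicator_def)
  then show ?thesis using e(1) that by blast
qed

section \<open>Two-sided bounds by the stationary functional\<close>

text \<open>The factor \<open>lam ^ n\<close> offsets the growth in \<open>F_dualT\<close>, so that
  a and b can be compared across n. The signs are recorded because \<open>ennreal\<close> sends
  negative reals to 0; finiteness of \<open>F g\<close> lets \<open>squeezedE\<close> and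
  \<open>squeezedI\<close> pass to real arithmetic.\<close>

definition squeezed :: "real \<Rightarrow> real \<Rightarrow> nat \<Rightarrow> real \<Rightarrow> bool" where
  "squeezed a b n x \<longleftrightarrow> 0 \<le> a \<and> 0 \<le> b \<and> (\<forall>g\<in>borel_measurable borel. F g < \<infinity> \<longrightarrow>
     ennreal (a * lam ^ n) * F g \<le> (dualT ^^ n) g x \<and> (dualT ^^ n) g x \<le> ennreal (b * lam ^ n) * F g)"

lemma squeezedE:
  assumes "squeezed a b n x" "g \<in> borel_measurable borel" "F g = ennreal G" "0 \<le> G"
  obtains u where "(dualT ^^ n) g x = ennreal u" "a * lam ^ n * G \<le> u" "u \<le> b * lam ^ n * G" "0 \<le> u"
proof -
  have ab: "0 \<le> a * lam ^ n" "0 \<le> b * lam ^ n"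
    using assms(1) lam_pos by (auto simp: squeezed_def)
  have *: "ennreal (a * lam ^ n * G) \<le> (dualT ^^ n) g x" "(dualT ^^ n) g x \<le> ennreal (b * lam ^ n * G)"
    using assms ab by (auto simp: squeezed_def ennreal_mult)
  then have "(dualT ^^ n) g x \<noteq> \<infinity>" by (auto simp: top_unique)
  then obtain u where "(dualT ^^ n) g x = ennreal u" "0 \<le> u" by (cases "(dualT ^^ n) g x") auto
  then show ?thesis using * ab assms(4) that[of u] by auto
qed

lemma squeezedI:
  assumes "0 \<le> a" "0 \<le> b"
    and "\<And>g G. g \<in> borel_measurable borel \<Longrightarrow> F g = ennreal G \<Longrightarrow> 0 \<le> G \<Longrightarrow>
      \<exists>u. (dualT ^^ n) g x = ennreal u \<and> a * lam ^ n * G \<le> u \<and> u \<le> b * lam ^ n * G"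
  shows "squeezed a b n x"
  unfolding squeezed_def
proof (intro conjI ballI impI)
  fix g assume g: "g \<in> borel_measurable borel" "F g < \<infinity>"
  then obtain G where G: "F g = ennreal G" "0 \<le> G" by (cases "F g") auto
  then obtain u where u: "(dualT ^^ n) g x = ennreal u" "a * lam ^ n * G \<le> u" "u \<le> b * lam ^ n * G"
    using assms(3) g by blast
  show "ennreal (a * lam ^ n) * F g \<le> (dualT ^^ n) g x" "(dualT ^^ n) g x \<le> ennreal (b * lam ^ n) * F g"
    using u G assms(1,2) lam_pos by (auto simp flip: ennreal_mult intro: ennreal_leI)
qed (use assms in auto)

text \<open>The bounds for n are applied to \<open>dualT g\<close>, and \<open>F_dualT\<close>
  supplies the missing factor \<open>lam\<close>. Bounds once found thus persist at all later times,
  of either parity.\<close>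

lemma squeezed_add: "squeezed a b n x \<Longrightarrow> squeezed a b (n + k) x"
proof (induction k)
  case (Suc k)
  show ?case
  proof (rule squeezedI)
    fix g G assume g: "g \<in> borel_measurable borel" "F g = ennreal G" "0 \<le> G"
    then have "F (dualT g) = ennreal (lam * G)" "0 \<le> lam * G"
      using lam_pos by (auto simp: F_dualT ennreal_mult)
    from squeezedE[OF Suc.IH[OF Suc.prems] _ this] g(1)
    obtain u where "(dualT ^^ (n + k)) (dualT g) x = ennreal u"
      "a * lam ^ (n + k) * (lam * G) \<le> u" "u \<le> b * lam ^ (n + k) * (lam * G)" by auto
    then show "\<exists>u. (dualT ^^ (n + Suc k)) g x = ennreal u \<and> a * lam ^ (n + Suc k) * G \<le> u \<and> u \<le> b * lam ^ (n + Suc k) * G"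
      by (intro exI[of _ u]) (auto simp: funpow_swap1 ac_simps)
  qed (use Suc.prems in \<open>auto simp: squeezed_def\<close>)
qed simp

lemma squeezed_le:
  assumes "squeezed a b n x"
  shows "a \<le> b"
proof -
  obtain u where "a * lam ^ n * 1 \<le> u" "u \<le> b * lam ^ n * 1"
    using squeezedE[OF assms, of "\<lambda>_. 1" 1] F_one by auto
  then have "a * lam ^ n \<le> b * lam ^ n" by linarith
  then show ?thesis using lam_pos by simp
qed

text \<open>The k doublings leave the value unchanged but are counted by the normalisation, hence
  the division by \<open>lam ^ k\<close>.\<close>

lemma squeezed_doubling:
  assumes "squeezed a b n (2 ^ k * x)" "0 \<le> x" "2 ^ k * x \<le> 2"
  shows "squeezed (a / lam ^ k) (b / lam ^ k) (k + n) x"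
proof (rule squeezedI)
  fix g G assume g: "g \<in> borel_measurable borel" "F g = ennreal G" "0 \<le> G"
  from squeezedE[OF assms(1) g] obtain u where
    u: "(dualT ^^ n) g (2 ^ k * x) = ennreal u" "a * lam ^ n * G \<le> u" "u \<le> b * lam ^ n * G" by auto
  have "(dualT ^^ (k + n)) g x = ennreal u"
    using dualT_funpow_doubling[OF assms(3,2), of "(dualT ^^ n) g"] u(1) by (simp add: funpow_add)
  then show "\<exists>u. (dualT ^^ (k + n)) g x = ennreal u \<and> a / lam ^ k * lam ^ (k + n) * G \<le> u
      \<and> u \<le> b / lam ^ k * lam ^ (k + n) * G"
    using u lam_pos by (auto simp: power_add)
qed (use assms lam_pos in \<open>auto simp: squeezed_def\<close>)

lemma F_J: obtains j where "F J = ennreal j" "0 < j"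
proof -
  obtain m where m: "0 < m" "\<And>t. 0 < t \<Longrightarrow> t \<le> 2 \<Longrightarrow> m \<le> f t" using f_lower_bound by blast
  have "F J \<le> F (\<lambda>_. 1)"
    unfolding F_def J_def by (intro nn_integral_mono mult_left_mono) (auto simp: indicator_def)
  then have "F J \<noteq> \<infinity>" by (auto simp: F_one top_unique)
  then obtain j where j: "F J = ennreal j" "0 \<le> j" by (cases "F J") auto
  have "ennreal (m / 4) = (\<integral>\<^sup>+t. ennreal m * indicator {7 / 4<..<2::real} t \<partial>lborel)"
    using m by (simp add: nn_integral_cmult flip: ennreal_mult)
  also have "\<dots> \<le> F J"
    unfolding F_def using m by (intro nn_integral_mono) (auto simp: dens_def J_def indicator_def intro: ennreal_leI)
  finally have "m / 4 \<le> j" using j m by simp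
  then show ?thesis using that j m by auto
qed

text \<open>Two applications of \<open>dualT\<close> split into a known multiple of \<open>J\<close>
  and a nonnegative remainder r. The value at \<open>J\<close> is one number P, the same in both
  bounds, so uncertainty remains only for r, whose share of the F-mass is q. This q depends on none
  of a, b, n, x.\<close>

lemma contraction:
  obtains q where "0 \<le> q" "q < 1"
    "\<And>a b n x. squeezed a b n x \<Longrightarrow> \<exists>a' b'. a \<le> a' \<and> b' - a' \<le> q * (b - a) \<and> squeezed a' b' (n + 2) x"
proof -
  obtain e where e: "0 < e"
    "\<And>g x. g \<in> borel_measurable borel \<Longrightarrow> ennreal e * F g * J x \<le> dualT (dualT g) x"
    by (rule minorization) blast
  obtain j where j: "F J = ennreal j" "0 < j" by (rule F_J)
  have split: "\<exists>r. r \<in> borel_measurable borel \<and> F r = ennreal ((lam\<^sup>2 - e * j) * G) \<and> 0 \<le> (lam\<^sup>2 - e * j) * G \<and>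
      dualT (dualT g) = (\<lambda>x. ennreal (e * G) * J x + r x)"
    if g: "g \<in> borel_measurable borel" "F g = ennreal G" "0 \<le> G" for g G
  proof -
    define r where "r = (\<lambda>x. dualT (dualT g) x - ennreal (e * G) * J x)"
    have [measurable]: "r \<in> borel_measurable borel" unfolding r_def using g(1) by measurable
    have "ennreal (e * G) * J x \<le> dualT (dualT g) x" for x
      using e(2)[OF g(1), of x] e(1) g by (simp add: ennreal_mult)
    then have eq: "dualT (dualT g) = (\<lambda>x. ennreal (e * G) * J x + r x)"
      by (simp add: r_def fun_eq_iff add_diff_inverse_ennreal)
    have "ennreal (lam\<^sup>2 * G) = F (dualT (dualT g))"
      using g lam_pos by (simp add: F_dualT dualT_measurable power2_eq_square ennreal_mult mult.assoc)
    also have "\<dots> = ennreal (e * G * j) + F r"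
      unfolding eq using e(1) g j by (simp add: F_add_scaled ennreal_mult)
    finally have *: "ennreal (lam\<^sup>2 * G) = ennreal (e * G * j) + F r" .
    then have "F r \<noteq> \<infinity>" by auto
    then obtain R where R: "F r = ennreal R" "0 \<le> R" by (cases "F r") auto
    have "lam\<^sup>2 * G = e * G * j + R"
      using * R e(1) g j lam_pos by (simp flip: ennreal_plus)
    then have "R = (lam\<^sup>2 - e * j) * G" by (simp add: algebra_simps)
    then show ?thesis using R eq by (intro exI[of _ r]) auto
  qed
  define q where "q = 1 - e * j / lam\<^sup>2"
  \<comment> \<open>Splitting for g = 1 shows e j <= lam^2, because the remainder has nonnegative
    F-mass.\<close>
  have "0 \<le> (lam\<^sup>2 - e * j) * 1" using split[of "\<lambda>_. 1" 1] F_one by auto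
  then have q: "0 \<le> q" "q < 1" using e(1) j lam_pos by (auto simp: q_def)
  show ?thesis
  proof (rule that[OF q])
    fix a b n x assume sq: "squeezed a b n x"
    have ab: "0 \<le> a" "0 \<le> b" using sq by (auto simp: squeezed_def)
    obtain P where P: "(dualT ^^ n) J x = ennreal P" "a * lam ^ n * j \<le> P" "P \<le> b * lam ^ n * j" "0 \<le> P"
      using squeezedE[OF sq J_measurable j(1)] j by auto
    define p where "p = P / lam ^ n"
    have Pp: "P = p * lam ^ n" using lam_pos by (simp add: p_def)
    have p: "a * j \<le> p" "p \<le> b * j" using P lam_pos by (auto simp: p_def field_simps)
    \<comment> \<open>Obtained by bounding r from below by a and from above by b, adding the
      contribution e G P of \<open>J\<close>, and dividing by
      \<open>lam ^ (n + 2) * G\<close>.\<close>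
    define a' where "a' = a + e / lam\<^sup>2 * (p - a * j)"
    define b' where "b' = b - e / lam\<^sup>2 * (b * j - p)"
    have "a \<le> a'" using p e(1) by (simp add: a'_def)
    have diff: "b' - a' = q * (b - a)"
      using lam_pos by (simp add: a'_def b'_def q_def field_simps)
    have "0 \<le> b'" using diff q \<open>a \<le> a'\<close> ab squeezed_le[OF sq] by (smt (verit) mult_nonneg_nonneg)
    have "squeezed a' b' (n + 2) x"
    proof (rule squeezedI)
      fix g G assume g: "g \<in> borel_measurable borel" "F g = ennreal G" "0 \<le> G"
      obtain r where r: "r \<in> borel_measurable borel" "F r = ennreal ((lam\<^sup>2 - e * j) * G)"
        "0 \<le> (lam\<^sup>2 - e * j) * G" "dualT (dualT g) = (\<lambda>x. ennreal (e * G) * J x + r x)"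
        using split[OF g] by blast
      obtain Q where Q: "(dualT ^^ n) r x = ennreal Q" "a * lam ^ n * ((lam\<^sup>2 - e * j) * G) \<le> Q"
        "Q \<le> b * lam ^ n * ((lam\<^sup>2 - e * j) * G)" "0 \<le> Q"
        using squeezedE[OF sq r(1-3)] by blast
      have "(dualT ^^ (n + 2)) g x = (dualT ^^ n) (dualT (dualT g)) x"
        by (simp add: funpow_swap1 numeral_2_eq_2)
      also have "\<dots> = ennreal (e * G * P + Q)"
        unfolding r(4) using r(1) P Q e(1) g(3) by (simp add: dualT_funpow_add_scaled ennreal_mult)
      finally have "(dualT ^^ (n + 2)) g x = ennreal (e * G * P + Q)" .
      moreover have "a' * lam ^ (n + 2) * G = a * lam ^ n * ((lam\<^sup>2 - e * j) * G) + e * G * P"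
        using lam_pos by (simp add: a'_def Pp power_add field_simps power2_eq_square)
      moreover have "b' * lam ^ (n + 2) * G = b * lam ^ n * ((lam\<^sup>2 - e * j) * G) + e * G * P"
        using lam_pos by (simp add: b'_def Pp power_add field_simps power2_eq_square)
      ultimately show "\<exists>u. (dualT ^^ (n + 2)) g x = ennreal u \<and> a' * lam ^ (n + 2) * G \<le> u \<and> u \<le> b' * lam ^ (n + 2) * G"
        using Q by auto
    qed (use \<open>a \<le> a'\<close> ab \<open>0 \<le> b'\<close> in auto)
    then show "\<exists>a' b'. a \<le> a' \<and> b' - a' \<le> q * (b - a) \<and> squeezed a' b' (n + 2) x"
      using \<open>a \<le> a'\<close> diff by (intro exI[of _ a'] exI[of _ b'] conjI) simp_all
  qed
qed

section \<open>Starting bounds at a given point\<close>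

text \<open>For x > 1 one step averages g over an interval inside [0,2], and the lower bound m on
  the density bounds Lebesgue measure there by F / m.\<close>

lemma initial_upper:
  assumes "1 < x" "x \<le> 2"
  obtains b where "squeezed 0 b 1 x"
proof -
  obtain m where m: "0 < m" "\<And>t. 0 < t \<Longrightarrow> t \<le> 2 \<Longrightarrow> m \<le> f t" using f_lower_bound by blast
  have AE0: "AE y in lborel. y \<noteq> (0::real)" by (rule AE_lborel_singleton)
  \<comment> \<open>The division by \<open>lam\<close> cancels the factor \<open>lam ^ 1\<close> in
    \<open>squeezed\<close>.\<close>
  define b where "b = 1 / (x - 1) * (1 / m) / lam"
  have "squeezed 0 b 1 x"
  proof (rule squeezedI)
    fix g G assume g: "g \<in> borel_measurable borel" "F g = ennreal G" "0 \<le> G"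
    note [measurable] = g(1)
    have "(\<integral>\<^sup>+y. g y * indicator {0..2 * (x - 1)} y \<partial>lborel) \<le> (\<integral>\<^sup>+y. ennreal (1 / m) * (dens y * g y) \<partial>lborel)"
    proof (rule nn_integral_mono_AE, use AE0 in eventually_elim)
      fix y :: real assume y: "y \<noteq> 0"
      show "g y * indicator {0..2 * (x - 1)} y \<le> ennreal (1 / m) * (dens y * g y)"
      proof (cases "0 < y \<and> y \<le> 2")
        case True
        have "1 \<le> ennreal (1 / m * f y)" using m True by (simp add: field_simps)
        also have "\<dots> = ennreal (1 / m) * dens y" using m True f_nonneg[of y]
          by (subst ennreal_mult) (auto simp: dens_def)
        finally have "1 * g y \<le> ennreal (1 / m) * dens y * g y" by (rule mult_right_mono) simp
        then show ?thesis by (auto simp: indicator_def mult.assoc)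
      qed (use y assms in \<open>auto simp: indicator_def\<close>)
    qed
    also have "\<dots> = ennreal (1 / m) * F g" unfolding F_def by (rule nn_integral_cmult) simp
    finally have "dualT g x \<le> ennreal (1 / (x - 1)) * (ennreal (1 / m) * F g)"
      using assms by (auto simp: dualT_average intro!: mult_left_mono)
    also have "\<dots> = ennreal (b * lam * G)"
      using assms m g lam_pos by (simp add: b_def flip: ennreal_mult)
    finally have *: "dualT g x \<le> ennreal (b * lam * G)" .
    then have "dualT g x \<noteq> \<infinity>" by (auto simp: top_unique)
    then obtain u where u: "dualT g x = ennreal u" "0 \<le> u" by (cases "dualT g x") auto
    have "0 \<le> b * lam * G" using assms m g lam_pos by (simp add: b_def)
    then show "\<exists>u. (dualT ^^ 1) g x = ennreal u \<and> 0 * lam ^ 1 * G \<le> u \<and> u \<le> b * lam ^ 1 * G"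
      using u * by auto
  qed (use assms m lam_pos in \<open>auto simp: b_def\<close>)
  then show ?thesis by (rule that)
qed

text \<open>For large k the averaging interval [0, 2(x - 1)] contains the copy of (7/4,2) scaled by
  2^(-k), and k doublings carry this copy into the support of \<open>J\<close>.\<close>

lemma reaches_J:
  assumes "1 < x"
  obtains k where "0 < (dualT ^^ Suc k) J x"
proof -
  obtain k where k: "1 / (x - 1) < 2 ^ k" using real_arch_pow[of 2] by auto
  define I where "I = {7 / 4 / 2 ^ k<..<2 / 2 ^ k :: real}"
  have "indicator I y \<le> (dualT ^^ k) J y * indicator {0..2 * (x - 1)} y" for y
  proof (cases "y \<in> I")
    case True
    then have y: "7 / 4 < 2 ^ k * y" "2 ^ k * y < 2" by (auto simp: I_def field_simps)
    have "0 < 7 / 4 / (2::real) ^ k" by simp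
    then have y0: "0 < y" using True by (auto simp: I_def)
    have "2 / 2 ^ k \<le> 2 * (x - 1)" using k assms by (simp add: field_simps)
    then have "y \<le> 2 * (x - 1)" using True by (auto simp: I_def)
    moreover have "(dualT ^^ k) J y = 1" using y y0 by (subst dualT_funpow_doubling) (auto simp: J_def)
    ultimately show ?thesis using y0 by (auto simp: indicator_def)
  qed auto
  then have "(\<integral>\<^sup>+y. indicator I y \<partial>lborel) \<le> (\<integral>\<^sup>+y. (dualT ^^ k) J y * indicator {0..2 * (x - 1)} y \<partial>lborel)"
    by (intro nn_integral_mono)
  moreover have "0 < (\<integral>\<^sup>+y. indicator I y \<partial>lborel)"
  proof -
    have "7 / 4 / 2 ^ k < 2 / (2::real) ^ k" by (simp add: field_simps)
    then show ?thesis by (simp add: I_def)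
  qed
  ultimately have "0 < (\<integral>\<^sup>+y. (dualT ^^ k) J y * indicator {0..2 * (x - 1)} y \<partial>lborel)" by order
  then have "0 < dualT ((dualT ^^ k) J) x"
    using assms by (simp add: dualT_average dualT_funpow_measurable ennreal_zero_less_mult_iff)
  then show ?thesis using that by simp
qed

text \<open>Doubling moves x into (1,2]. There the upper bound holds after one step and persists;
  the lower bound applies the iterate that is positive on \<open>J\<close> to the Doeblin
  bound.\<close>

lemma initial_squeeze:
  assumes "0 < x" "x \<le> 2"
  obtains a b n where "0 < a" "squeezed a b n x"
proof -
  obtain k where k: "1 < 2 ^ k * x" "2 ^ k * x \<le> 2"
  proof -
    obtain K where "1 / x < 2 ^ K" using real_arch_pow[of 2] by auto
    then have K: "1 < 2 ^ K * x" using assms by (simp add: field_simps)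
    \<comment> \<open>The least number of doublings that passes 1: its predecessor gives at most 1,
      so this one gives at most 2.\<close>
    define k where "k = (LEAST k. 1 < 2 ^ k * x)"
    have k1: "1 < 2 ^ k * x" unfolding k_def by (rule LeastI) (rule K)
    have "2 ^ k * x \<le> 2"
    proof (cases k)
      case (Suc k')
      then have "\<not> 1 < 2 ^ k' * x" using not_less_Least[of k' "\<lambda>k. 1 < 2 ^ k * x"] by (simp add: k_def)
      then show ?thesis using Suc by simp
    qed (use assms in simp)
    then show ?thesis using k1 that by blast
  qed
  let ?y = "2 ^ k * x"
  obtain b where b: "squeezed 0 b 1 ?y" using initial_upper[OF k] by blast
  obtain i where i: "0 < (dualT ^^ Suc i) J ?y" using reaches_J[OF k(1)] by blast
  have sq: "squeezed 0 b (Suc i) ?y" using squeezed_add[OF b, of i] by simp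
  obtain e where e: "0 < e"
    "\<And>g x. g \<in> borel_measurable borel \<Longrightarrow> ennreal e * F g * J x \<le> dualT (dualT g) x"
    by (rule minorization) blast
  obtain j where j: "F J = ennreal j" "0 < j" by (rule F_J)
  obtain P where P: "(dualT ^^ Suc i) J ?y = ennreal P"
    using squeezedE[OF sq J_measurable j(1)] j by auto
  then have P0: "0 < P" using i by (auto simp del: funpow.simps)
  \<comment> \<open>The time is \<open>Suc i\<close> steps, after which \<open>J\<close> has the
    positive value P, plus two steps for the Doeblin bound.\<close>
  define a where "a = e * P / lam ^ (Suc i + 2)"
  have a: "0 < a" using e(1) P0 lam_pos by (simp add: a_def)
  have "squeezed a b (Suc i + 2) ?y"
  proof (rule squeezedI)
    fix g G assume g: "g \<in> borel_measurable borel" "F g = ennreal G" "0 \<le> G"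
    obtain u where u: "(dualT ^^ (Suc i + 2)) g ?y = ennreal u" "0 \<le> u" "u \<le> b * lam ^ (Suc i + 2) * G"
      using squeezedE[OF squeezed_add[OF sq, of 2] g] by blast
    have "ennreal (e * G * P) = ennreal (e * G) * (dualT ^^ Suc i) J ?y"
      using P e(1) g P0 by (simp add: ennreal_mult del: funpow.simps)
    \<comment> \<open>The zero function is added only to match the form of
      \<open>dualT_funpow_add_scaled\<close>.\<close>
    also have "\<dots> \<le> ennreal (e * G) * (dualT ^^ Suc i) J ?y + (dualT ^^ Suc i) (\<lambda>_. 0) ?y"
      by (rule add_increasing2) auto
    also have "\<dots> = (dualT ^^ Suc i) (\<lambda>x. ennreal (e * G) * J x + 0) ?y"
      by (subst dualT_funpow_add_scaled) auto
    also have "\<dots> \<le> (dualT ^^ Suc i) (dualT (dualT g)) ?y"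
      using e(2)[OF g(1)] e(1) g by (intro dualT_funpow_mono) (simp add: ennreal_mult)
    also have "\<dots> = ennreal u"
      unfolding u(1)[symmetric] by (simp add: funpow_add numeral_2_eq_2 funpow_swap1)
    finally have "e * G * P \<le> u" using u by simp
    then show "\<exists>u. (dualT ^^ (Suc i + 2)) g ?y = ennreal u \<and> a * lam ^ (Suc i + 2) * G \<le> u \<and> u \<le> b * lam ^ (Suc i + 2) * G"
      using u lam_pos by (intro exI[of _ u]) (auto simp: a_def ac_simps)
  qed (use a sq in \<open>auto simp: squeezed_def\<close>)
  from squeezed_doubling[OF this] assms k a lam_pos show ?thesis
    by (intro that[of "a / lam ^ k"]) auto
qed

section \<open>Passage to the limit\<close>

text \<open>With G the value of F at g, both S^n g and G S^n 1 lie between a' lam^n G and b' lam^n G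
  at x, and b' - a' decays geometrically. The denominator stays at least a lam^n because
  \<open>contraction\<close> never lowers the lower bound.\<close>

lemma ratio_tendsto:
  assumes x: "0 < x" "x \<le> 2" and g: "g \<in> borel_measurable borel" "F g < \<infinity>"
  shows "(\<lambda>n. enn2real ((dualT ^^ n) g x / (dualT ^^ n) (\<lambda>_. 1) x)) \<longlonglongrightarrow> enn2real (F g)"
proof -
  obtain a b N where a: "0 < a" and sq: "squeezed a b N x" by (rule initial_squeeze[OF x])
  obtain q where q: "0 \<le> q" "q < 1" and contr:
    "\<And>a b n x. squeezed a b n x \<Longrightarrow> \<exists>a' b'. a \<le> a' \<and> b' - a' \<le> q * (b - a) \<and> squeezed a' b' (n + 2) x"
    by (rule contraction) blast
  obtain G where G: "F g = ennreal G" "0 \<le> G" using g(2) by (cases "F g") auto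
  have iter: "\<exists>a' b'. a \<le> a' \<and> b' - a' \<le> q ^ k * (b - a) \<and> squeezed a' b' (N + 2 * k) x" for k
  proof (induction k)
    case 0
    show ?case using sq by auto
  next
    case (Suc k)
    then obtain a1 b1 where 1: "a \<le> a1" "b1 - a1 \<le> q ^ k * (b - a)" "squeezed a1 b1 (N + 2 * k) x" by blast
    obtain a2 b2 where 2: "a1 \<le> a2" "b2 - a2 \<le> q * (b1 - a1)" "squeezed a2 b2 (N + 2 * k + 2) x"
      using contr[OF 1(3)] by blast
    have "q * (b1 - a1) \<le> q * (q ^ k * (b - a))" using 1 q by (intro mult_left_mono) auto
    then have "b2 - a2 \<le> q ^ Suc k * (b - a)" using 2(2) by (simp add: mult.assoc)
    moreover have "N + 2 * k + 2 = N + 2 * Suc k" by simp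
    ultimately show ?case using 1(1) 2(1,3) by (metis order_trans)
  qed
  \<comment> \<open>The contracted bounds are known at the times N + 2k only;
    \<open>squeezed_add\<close> carries them to every later n.\<close>
  have bound: "\<bar>enn2real ((dualT ^^ n) g x / (dualT ^^ n) (\<lambda>_. 1) x) - G\<bar> \<le> q ^ k * ((b - a) * G / a)"
    if n: "N + 2 * k \<le> n" for n k
  proof -
    obtain a' b' where 1: "a \<le> a'" "b' - a' \<le> q ^ k * (b - a)" "squeezed a' b' (N + 2 * k) x" using iter by blast
    have s: "squeezed a' b' n x" using squeezed_add[OF 1(3), of "n - (N + 2 * k)"] n by simp
    define L where "L = lam ^ n"
    have L: "0 < L" using lam_pos by (simp add: L_def)
    obtain u where u: "(dualT ^^ n) g x = ennreal u" "a' * L * G \<le> u" "u \<le> b' * L * G" "0 \<le> u"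
      using squeezedE[OF s g(1) G] unfolding L_def by blast
    obtain v where v: "(dualT ^^ n) (\<lambda>_. 1) x = ennreal v" "a' * L \<le> v" "v \<le> b' * L"
      using squeezedE[OF s, of "\<lambda>_. 1" 1] F_one unfolding L_def by auto
    have aL: "0 < a * L" using a L by simp
    have av: "a * L \<le> v" using order_trans[OF mult_right_mono[OF 1(1)] v(2)] L by simp
    then have "0 < v" using aL by linarith
    have "a' * L * G \<le> v * G" "v * G \<le> b' * L * G" using v(2,3) G(2) by (simp_all add: mult_right_mono)
    then have "\<bar>u - G * v\<bar> \<le> (b' - a') * L * G" using u(2,3) unfolding abs_le_iff left_diff_distrib mult.commute[of G] by linarith
    also have "\<dots> \<le> q ^ k * (b - a) * L * G" using 1(2) L G(2) by (intro mult_right_mono) auto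
    finally have num: "\<bar>u - G * v\<bar> \<le> q ^ k * (b - a) * L * G" .
    have "\<bar>u - G * v\<bar> / v \<le> q ^ k * (b - a) * L * G / (a * L)"
      by (rule frac_le[OF order_trans[OF abs_ge_zero num] num aL av])
    moreover have "\<bar>u - G * v\<bar> / v = \<bar>u / v - G\<bar>"
      using \<open>0 < v\<close> by (simp add: diff_divide_distrib abs_div_pos)
    moreover have "enn2real (ennreal u / ennreal v) = u / v"
      using u \<open>0 < v\<close> by (simp add: divide_ennreal)
    moreover have "q ^ k * (b - a) * L * G / (a * L) = q ^ k * ((b - a) * G / a)"
      using L a by (simp add: field_simps)
    ultimately show ?thesis unfolding u(1) v(1) by simp
  qed
  have lim: "(\<lambda>k. q ^ k * ((b - a) * G / a)) \<longlonglongrightarrow> 0"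
    using q by (intro tendsto_mult_left_zero LIMSEQ_realpow_zero) auto
  have "(\<lambda>n. enn2real ((dualT ^^ n) g x / (dualT ^^ n) (\<lambda>_. 1) x)) \<longlonglongrightarrow> G"
  proof (rule LIMSEQ_I)
    fix r :: real assume "0 < r"
    from LIMSEQ_D[OF lim this] obtain k where k: "\<bar>q ^ k * ((b - a) * G / a)\<bar> < r" by auto
    then show "\<exists>no. \<forall>n\<ge>no. norm (enn2real ((dualT ^^ n) g x / (dualT ^^ n) (\<lambda>_. 1) x) - G) < r"
    proof (intro exI[of _ "N + 2 * k"] allI impI)
      fix n assume "N + 2 * k \<le> n"
      from bound[OF this] k show "norm (enn2real ((dualT ^^ n) g x / (dualT ^^ n) (\<lambda>_. 1) x) - G) < r"
        unfolding real_norm_def by linarith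
    qed
  qed
  then show ?thesis using G by simp
qed

text \<open>The shift by B makes g nonnegative, as F requires, and costs exactly B because the
  density has mass 1.\<close>

lemma F_truncation:
  assumes g: "continuous_on {0..2} g" "\<And>x. x \<in> {0..2} \<Longrightarrow> 0 \<le> g x + B"
  shows "F (\<lambda>x. ennreal (g x + B) * indicator {0..2} x) = ennreal ((LBINT t:{0..2}. g t * f t) + B)"
    and "0 \<le> (LBINT t:{0..2}. g t * f t) + B"
proof -
  obtain K where K: "\<And>x. x \<in> {0..2} \<Longrightarrow> \<bar>g x\<bar> \<le> K" using continuous_bounded[OF g(1)] by blast
  have fi: "integrable lborel (\<lambda>x. indicator {0<..2} x *\<^sub>R f x)"
    using f_integrable by (simp add: set_integrable_def)
  have "(\<lambda>x. indicator {0..2} x *\<^sub>R g x) \<in> borel_measurable borel"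
    using continuous_measurable[OF g(1)] by (subst (asm) borel_measurable_restrict_space_iff) auto
  then have gm: "(\<lambda>x. indicator {0..2} x *\<^sub>R g x) \<in> borel_measurable lborel" by simp
  have gi: "integrable lborel (\<lambda>t. indicator {0<..2} t *\<^sub>R (g t * f t))"
  proof (rule Bochner_Integration.integrable_bound)
    show "integrable lborel (\<lambda>t. K * (indicator {0<..2} t *\<^sub>R f t))"
      using fi by (intro integrable_mult_right) auto
    have "(\<lambda>t. (indicator {0..2} t *\<^sub>R g t) * (indicator {0<..2} t *\<^sub>R f t)) \<in> borel_measurable lborel"
      by (intro borel_measurable_times gm borel_measurable_integrable fi)
    also have "(\<lambda>t. (indicator {0..2} t *\<^sub>R g t) * (indicator {0<..2} t *\<^sub>R f t))
        = (\<lambda>t. indicator {0<..2} t *\<^sub>R (g t * f t))"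
      by (auto simp: fun_eq_iff indicator_def)
    finally show "(\<lambda>t. indicator {0<..2} t *\<^sub>R (g t * f t)) \<in> borel_measurable lborel" .
    have "\<bar>g t\<bar> * \<bar>f t\<bar> \<le> \<bar>K\<bar> * \<bar>f t\<bar>" if "0 < t" "t \<le> 2" for t
      using K[of t] that by (intro mult_right_mono) auto
    then show "AE t in lborel. norm (indicator {0<..2} t *\<^sub>R (g t * f t)) \<le> norm (K * (indicator {0<..2} t *\<^sub>R f t))"
      by (intro AE_I2) (auto simp: indicator_def abs_mult)
  qed
  have nonneg: "0 \<le> indicator {0<..2} t *\<^sub>R (g t * f t) + B * (indicator {0<..2} t *\<^sub>R f t)" for t :: real
  proof -
    have "0 \<le> (g t + B) * f t" if "0 < t" "t \<le> 2"
      using that g(2)[of t] f_nonneg[of t] by (intro mult_nonneg_nonneg) auto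
    then show ?thesis by (auto simp: indicator_def distrib_right)
  qed
  have split: "(LBINT t. indicator {0<..2} t *\<^sub>R (g t * f t) + B * (indicator {0<..2} t *\<^sub>R f t))
      = (LBINT t:{0..2}. g t * f t) + B"
  proof -
    have "(LBINT t. indicator {0<..2} t *\<^sub>R (g t * f t) + B * (indicator {0<..2} t *\<^sub>R f t))
        = (LBINT t. indicator {0<..2} t *\<^sub>R (g t * f t)) + B * (LBINT t. indicator {0<..2} t *\<^sub>R f t)"
      using gi fi by (subst Bochner_Integration.integral_add) auto
    also have "(LBINT t. indicator {0<..2} t *\<^sub>R f t) = 1"
      using f_total by (simp add: set_lebesgue_integral_def)
    \<comment> \<open>The two domains differ by the null set {0}.\<close>
    also have "(LBINT t. indicator {0<..2} t *\<^sub>R (g t * f t)) = (LBINT t:{0..2}. g t * f t)"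
      unfolding set_lebesgue_integral_def
      by (rule integral_discrete_difference[of "{0}"]) (auto simp: indicator_def)
    finally show ?thesis by simp
  qed
  show "0 \<le> (LBINT t:{0..2}. g t * f t) + B"
    unfolding split[symmetric] using nonneg by (intro Bochner_Integration.integral_nonneg)
  have "F (\<lambda>x. ennreal (g x + B) * indicator {0..2} x)
      = (\<integral>\<^sup>+t. ennreal (indicator {0<..2} t *\<^sub>R (g t * f t) + B * (indicator {0<..2} t *\<^sub>R f t)) \<partial>lborel)"
    unfolding F_def
  proof (intro nn_integral_cong)
    fix t :: real
    show "dens t * (ennreal (g t + B) * indicator {0..2} t)
        = ennreal (indicator {0<..2} t *\<^sub>R (g t * f t) + B * (indicator {0<..2} t *\<^sub>R f t))"
    proof (cases "0 < t \<and> t \<le> 2")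
      case True
      then have "ennreal (f t) * ennreal (g t + B) = ennreal (f t * (g t + B))"
        using g(2)[of t] f_nonneg[of t] by (intro ennreal_mult[symmetric]) auto
      then show ?thesis using True by (simp add: dens_def algebra_simps)
    qed (auto simp: dens_def)
  qed
  also have "\<dots> = ennreal (LBINT t. indicator {0<..2} t *\<^sub>R (g t * f t) + B * (indicator {0<..2} t *\<^sub>R f t))"
    using gi fi nonneg
    by (intro nn_integral_eq_integral Bochner_Integration.integrable_add integrable_mult_right) auto
  finally show "F (\<lambda>x. ennreal (g x + B) * indicator {0..2} x) = ennreal ((LBINT t:{0..2}. g t * f t) + B)"
    unfolding split .
qed

end

theorem corollary6p5:
  fixes f :: "real \<Rightarrow> real" and x :: real
  assumes "is_fstar f"
    and "0 < x" and "x \<le> 2"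
  shows "\<forall>g. continuous_on {0..2} g \<longrightarrow>
    (\<lambda>n. pairing g ((That ^^ n) (return I02 x))) \<longlonglongrightarrow> (LBINT t:{0..2}. g t * f t)"
proof (intro allI impI)
  interpret fstar f by unfold_locales (rule assms(1))
  fix g :: "real \<Rightarrow> real" assume g: "continuous_on {0..2} g"
  obtain B where B: "\<And>x. x \<in> {0..2} \<Longrightarrow> \<bar>g x\<bar> \<le> B" using continuous_bounded[OF g] by blast
  have g0: "0 \<le> g x + B" if "x \<in> {0..2}" for x using B[OF that] by linarith
  have gB: "continuous_on {0..2} (\<lambda>x. g x + B)" by (intro continuous_intros g)
  \<comment> \<open>The dual operator acts on nonnegative functions on the whole line: the shift by
    B secures the sign, the cut-off measurability. Since the iterates are probability measures,
    subtracting B undoes the shift.\<close>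
  define h where "h = (\<lambda>x. ennreal (g x + B) * indicator {0..2} x)"
  have hm: "h \<in> borel_measurable borel" unfolding h_def by (rule truncation_measurable[OF gB])
  have Fh: "F h = ennreal ((LBINT t:{0..2}. g t * f t) + B)"
    unfolding h_def by (rule F_truncation(1)[OF g g0])
  have P: "pairing g ((That ^^ n) (return I02 x)) = enn2real ((dualT ^^ n) h x / (dualT ^^ n) (\<lambda>_. 1) x) - B" for n
  proof -
    let ?\<mu> = "(That ^^ n) (return I02 x)"
    have M: "?\<mu> \<in> Mplus" "prob_space ?\<mu>" using That_iterate_prob[of x n] assms by auto
    then have "measure ?\<mu> {0..2} = 1" using MplusD(2) prob_space.prob_space by metis
    then have "pairing g ?\<mu> = pairing (\<lambda>x. g x + B) ?\<mu> - B"
      by (simp add: pairing_add_const[OF M(1) g])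
    also have "pairing (\<lambda>x. g x + B) ?\<mu> = enn2real (\<integral>\<^sup>+y. h y \<partial>?\<mu>)"
      unfolding h_def by (rule pairing_nn_integral[OF M(1) gB g0])
    also have "(\<integral>\<^sup>+y. h y \<partial>?\<mu>) = (dualT ^^ n) h x / (dualT ^^ n) (\<lambda>_. 1) x"
      using assms by (intro That_iterate hm) auto
    finally show ?thesis .
  qed
  have lim: "(\<lambda>n. enn2real ((dualT ^^ n) h x / (dualT ^^ n) (\<lambda>_. 1) x) - B) \<longlonglongrightarrow> enn2real (F h) - B"
    using assms Fh by (intro tendsto_diff ratio_tendsto hm tendsto_const) auto
  show "(\<lambda>n. pairing g ((That ^^ n) (return I02 x))) \<longlonglongrightarrow> (LBINT t:{0..2}. g t * f t)"
    using lim F_truncation(2)[OF g g0] unfolding P Fh by simp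
qed

end
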